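(* Let $R=\prod_{i=1}^{\infty}\mathbb{Z}/2\mathbb{Z}$, let $D=\bigoplus_{i=1}^{\infty}\mathbb{Z}/2\mathbb{Z}\subseteq R$, let $T$ be a maximal ideal of $R$ with $D\subseteq T$, and let $S=R/T$. Let $A$ be the commutative ring $$A=\left\{\begin{bmatrix} r & s\\ 0 & r\end{bmatrix} : r\in R,\ s\in S\right\}$$ with matrix addition and multiplication (i.e. $A=R\times S$ as an additive group, with $(r,s)(r',s')=(rr',rs'+sr')$), let $$J=\left\{\begin{bmatrix} 0 & s\\ 0 & 0\end{bmatrix} : s\in S\right\},$$ and let $M=A/J$. Then $M$ is a cyclically presented $A$-module which is not projective and has no nonzero stable submodule. Consequently, $M$ has no decomposition $M=P\oplus N$ with $P$ a projective submodule and $N$ a stable submodule, and moreover $M$ is not projectively equivalent to any stable $A$-module.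
   Context: A module is called stable if it has no nonzero projective direct summand. An $A$-module is cyclically presented if it is isomorphic to $A/I$ for a principal (right) ideal $I$ of $A$. Modules $X$ and $Y$ over the same ring are projectively equivalent if there exist projective modules $P$ and $Q$ with $X\oplus P\cong Y\oplus Q$. *)

theory Defs
  imports "HOL-Number_Theory.Residues" "HOL-Algebra.Chinese_Remainder" "HOL-Algebra.Module"
begin

section \<open>Modules over a commutative ring\<close>

definition module_hom ::
  "('a, 'c) ring_scheme \<Rightarrow> ('a, 'm, 'd) module_scheme \<Rightarrow> ('a, 'n, 'e) module_scheme \<Rightarrow> ('m \<Rightarrow> 'n) set"
  where "module_hom A M N =
    {f \<in> carrier M \<rightarrow> carrier N.
      (\<forall>x\<in>carrier M. \<forall>y\<in>carrier M. f (x \<oplus>\<^bsub>M\<^esub> y) = f x \<oplus>\<^bsub>N\<^esub> f y) \<and>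
      (\<forall>a\<in>carrier A. \<forall>x\<in>carrier M. f (a \<odot>\<^bsub>M\<^esub> x) = a \<odot>\<^bsub>N\<^esub> f x)}"

definition module_isomorphic ::
  "('a, 'c) ring_scheme \<Rightarrow> ('a, 'm, 'd) module_scheme \<Rightarrow> ('a, 'n, 'e) module_scheme \<Rightarrow> bool"
  where "module_isomorphic A M N \<longleftrightarrow> (\<exists>f\<in>module_hom A M N. bij_betw f (carrier M) (carrier N))"

definition quotient_module :: "('a, 'c) ring_scheme \<Rightarrow> 'a set \<Rightarrow> ('a, 'a set) module"
  where "quotient_module A I =
    ring.extend (A Quot I) (module.fields (\<lambda>a C. (I +>\<^bsub>A\<^esub> a) \<otimes>\<^bsub>A Quot I\<^esub> C))"

text \<open>The record type of modules extends that of rings; the fields \<open>mult\<close> and \<open>one\<close> of a module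
  play no role in the locale \<open>module\<close> nor in any definition below.\<close>

definition module_dirsum ::
  "('a, 'm, 'd) module_scheme \<Rightarrow> ('a, 'n, 'e) module_scheme \<Rightarrow> ('a, 'm \<times> 'n) module"
  where "module_dirsum M N =
    ring.extend (RDirProd M N) (module.fields (\<lambda>a (x, y). (a \<odot>\<^bsub>M\<^esub> x, a \<odot>\<^bsub>N\<^esub> y)))"

definition free_module :: "('a, 'c) ring_scheme \<Rightarrow> 'x set \<Rightarrow> ('a, 'x \<Rightarrow> 'a) module"
  where "free_module A B =
    \<lparr>carrier = {f \<in> B \<rightarrow>\<^sub>E carrier A. finite {x \<in> B. f x \<noteq> \<zero>\<^bsub>A\<^esub>}},
     monoid.mult = undefined, one = undefined,
     zero = (\<lambda>x\<in>B. \<zero>\<^bsub>A\<^esub>),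
     add = (\<lambda>f g. \<lambda>x\<in>B. f x \<oplus>\<^bsub>A\<^esub> g x),
     smult = (\<lambda>a f. \<lambda>x\<in>B. a \<otimes>\<^bsub>A\<^esub> f x)\<rparr>"

definition internal_dirsum ::
  "('a, 'c) ring_scheme \<Rightarrow> ('a, 'm, 'd) module_scheme \<Rightarrow> 'm set \<Rightarrow> 'm set \<Rightarrow> bool"
  where "internal_dirsum A M U V \<longleftrightarrow>
    submodule U A M \<and> submodule V A M \<and> U <+>\<^bsub>M\<^esub> V = carrier M \<and> U \<inter> V = {\<zero>\<^bsub>M\<^esub>}"

text \<open>Projective: isomorphic to a direct summand of a free module. It is no restriction that
  the basis \<open>B\<close> consists of elements of the type underlying \<open>P\<close>: a projective \<open>P\<close> is a
  direct summand of the free module with basis \<open>carrier P\<close>, because the canonical map from that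
  module onto \<open>P\<close> splits.\<close>

definition projective_module :: "('a, 'c) ring_scheme \<Rightarrow> ('a, 'm, 'd) module_scheme \<Rightarrow> bool"
  where "projective_module A P \<longleftrightarrow>
    module A P \<and>
    (\<exists>(B :: 'm set) U V. internal_dirsum A (free_module A B) U V \<and>
       module_isomorphic A P ((free_module A B)\<lparr>carrier := U\<rparr>))"

definition stable_module :: "('a, 'c) ring_scheme \<Rightarrow> ('a, 'm, 'd) module_scheme \<Rightarrow> bool"
  where "stable_module A M \<longleftrightarrow>
    module A M \<and>
    (\<forall>U V. internal_dirsum A M U V \<and> projective_module A (M\<lparr>carrier := U\<rparr>) \<longrightarrow> U = {\<zero>\<^bsub>M\<^esub>})"

definition cyclically_presented :: "('a, 'c) ring_scheme \<Rightarrow> ('a, 'm, 'd) module_scheme \<Rightarrow> bool"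
  where "cyclically_presented A M \<longleftrightarrow>
    module A M \<and> (\<exists>I. principalideal I A \<and> module_isomorphic A M (quotient_module A I))"

text \<open>A definition in HOL cannot quantify over types, so the types of the elements of the projective
  modules \<open>P\<close> and \<open>Q\<close> are parameters.\<close>

definition projectively_equivalent ::
  "'p itself \<Rightarrow> 'q itself \<Rightarrow> ('a, 'c) ring_scheme \<Rightarrow>
   ('a, 'm, 'd) module_scheme \<Rightarrow> ('a, 'n, 'e) module_scheme \<Rightarrow> bool"
  where "projectively_equivalent TP TQ A M N \<longleftrightarrow>
    module A M \<and> module A N \<and>
    (\<exists>(P :: ('a, 'p) module) (Q :: ('a, 'q) module).
       projective_module A P \<and> projective_module A Q \<and>
       module_isomorphic A (module_dirsum M P) (module_dirsum N Q))"

section \<open>The rings and modules of the example\<close>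

definition product_ring :: "'i set \<Rightarrow> ('i \<Rightarrow> ('a, 'c) ring_scheme) \<Rightarrow> ('i \<Rightarrow> 'a) ring"
  where "product_ring I F =
    \<lparr>carrier = (\<Pi>\<^sub>E i\<in>I. carrier (F i)),
     monoid.mult = (\<lambda>f g. \<lambda>i\<in>I. f i \<otimes>\<^bsub>F i\<^esub> g i),
     one = (\<lambda>i\<in>I. \<one>\<^bsub>F i\<^esub>),
     zero = (\<lambda>i\<in>I. \<zero>\<^bsub>F i\<^esub>),
     add = (\<lambda>f g. \<lambda>i\<in>I. f i \<oplus>\<^bsub>F i\<^esub> g i)\<rparr>"

text \<open>For an \<open>R\<close>-module \<open>S\<close>, the ring of matrices with rows \<open>(r, s)\<close> and \<open>(0, r)\<close>, where \<open>r\<close> is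
  in \<open>R\<close> and \<open>s\<close> in \<open>S\<close>; such a matrix is encoded as the pair \<open>(r, s)\<close>.\<close>

definition triangular_ring ::
  "('a, 'c) ring_scheme \<Rightarrow> ('a, 'm, 'd) module_scheme \<Rightarrow> ('a \<times> 'm) ring"
  where "triangular_ring R S =
    \<lparr>carrier = carrier R \<times> carrier S,
     monoid.mult = (\<lambda>(r, s) (r', s'). (r \<otimes>\<^bsub>R\<^esub> r', (r \<odot>\<^bsub>S\<^esub> s') \<oplus>\<^bsub>S\<^esub> (r' \<odot>\<^bsub>S\<^esub> s))),
     one = (\<one>\<^bsub>R\<^esub>, \<zero>\<^bsub>S\<^esub>),
     zero = (\<zero>\<^bsub>R\<^esub>, \<zero>\<^bsub>S\<^esub>),
     add = (\<lambda>(r, s) (r', s'). (r \<oplus>\<^bsub>R\<^esub> r', s \<oplus>\<^bsub>S\<^esub> s'))\<rparr>"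

definition ring_R :: "(nat \<Rightarrow> int) ring"
  where "ring_R = product_ring {1..} (\<lambda>_. residue_ring 2)"

definition ideal_D :: "(nat \<Rightarrow> int) set"
  where "ideal_D = {f \<in> carrier ring_R. finite {i \<in> {1..}. f i \<noteq> \<zero>\<^bsub>residue_ring 2\<^esub>}}"

definition module_S :: "(nat \<Rightarrow> int) set \<Rightarrow> (nat \<Rightarrow> int, (nat \<Rightarrow> int) set) module"
  where "module_S T = quotient_module ring_R T"

definition ring_A :: "(nat \<Rightarrow> int) set \<Rightarrow> ((nat \<Rightarrow> int) \<times> (nat \<Rightarrow> int) set) ring"
  where "ring_A T = triangular_ring ring_R (module_S T)"

definition ideal_J :: "(nat \<Rightarrow> int) set \<Rightarrow> ((nat \<Rightarrow> int) \<times> (nat \<Rightarrow> int) set) set"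
  where "ideal_J T = {(\<zero>\<^bsub>ring_R\<^esub>, s) | s. s \<in> carrier (module_S T)}"

definition module_M ::
  "(nat \<Rightarrow> int) set \<Rightarrow>
   ((nat \<Rightarrow> int) \<times> (nat \<Rightarrow> int) set, ((nat \<Rightarrow> int) \<times> (nat \<Rightarrow> int) set) set) module"
  where "module_M T = quotient_module (ring_A T) (ideal_J T)"

end

theory Submission
  imports Defs
begin

text \<open>
  Write \<open>\<kappa> = (0, 1)\<close>, so that \<open>J = A\<kappa>\<close> and \<open>\<kappa>\<^sup>2 = 0\<close>, and let \<open>e\<^sub>i \<in> A\<close> be the matrix \<open>(c\<^sub>i, 0)\<close> of
  the \<open>i\<close>-th coordinate idempotent \<open>c\<^sub>i\<close> of \<open>R\<close>. Since \<open>c\<^sub>i\<close> lies in \<open>D \<subseteq> T\<close>, it kills \<open>S\<close>, so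
  \<open>A e\<^sub>i = {0, e\<^sub>i}\<close> and \<open>e\<^sub>i \<kappa> = 0\<close>; conversely only the elements of \<open>J\<close> are killed by all \<open>e\<^sub>i\<close>.
  The whole argument uses little more than these facts, collected in the locale
  \<open>atoms_with_nilpotent_annihilator\<close>, and compares torsion with respect to the atoms \<open>e\<^sub>i\<close>.

  \<^item> A stable module is killed by every atom (\<open>stable_killed_by_atoms\<close>): for \<open>y = e\<^sub>i y \<noteq> 0\<close> the
    submodule \<open>A y = {0, y}\<close> is isomorphic to the projective module \<open>A e\<^sub>i\<close>, and it has a
    complement because the \<open>e\<^sub>i\<close>-part of a module is a vector space over the field \<open>A e\<^sub>i\<close>.
  \<^item> In \<open>M = A/J\<close> only \<open>0\<close> is killed by all atoms (\<open>M_atom_torsion_free\<close>). With the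
    preceding item, \<open>M\<close> has no nonzero stable submodule.
  \<^item> In a projective module the elements killed by all atoms are multiples of \<open>\<kappa>\<close>
    (\<open>projective_atom_torsion\<close>), since their coefficients in a free module lie in \<open>J\<close>.
  \<^item> The generator of \<open>M\<close> is killed by \<open>\<kappa>\<close>. In a projective module, an element killed by
    \<open>\<kappa>\<close> becomes a multiple of \<open>\<kappa>\<close> after multiplication by some \<open>t\<close> with \<open>t \<kappa> = \<kappa>\<close>
    (\<open>projective_\<kappa>_torsion\<close>): the coefficients are \<open>(r, s)\<close> with \<open>r \<in> T\<close>, and the product of
    the finitely many \<open>1 - r\<close> moves them into \<open>J\<close>. But \<open>\<kappa> M = 0\<close>, and \<open>t \<in> J\<close> would give
    \<open>\<kappa> = t \<kappa> = 0\<close> (\<open>M_generator\<close>). So \<open>M\<close> is not projective, and a decomposition of \<open>M\<close> into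
    a projective and a stable submodule, the latter being \<open>0\<close>, is impossible.

  Finally let \<open>M \<oplus> P \<cong> Y \<oplus> Q\<close> with \<open>Y\<close> stable. An element of \<open>Y\<close> is killed by all atoms, so by
  the second and third items it corresponds to some \<open>(0, \<kappa> p)\<close> and is therefore \<open>\<kappa>\<close> times an
  element of \<open>Y\<close>. Thus \<open>Y = \<kappa> Y = \<kappa>\<^sup>2 Y = 0\<close>. The generator of \<open>M\<close> then lies in the projective
  module \<open>Q\<close> up to isomorphism, which the last item excludes.
\<close>

section \<open>Modules over a commutative ring\<close>

lemma module_homD:
  assumes "f \<in> module_hom A M N"
  shows "x \<in> carrier M \<Longrightarrow> f x \<in> carrier N"
    and "x \<in> carrier M \<Longrightarrow> y \<in> carrier M \<Longrightarrow> f (x \<oplus>\<^bsub>M\<^esub> y) = f x \<oplus>\<^bsub>N\<^esub> f y"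
    and "a \<in> carrier A \<Longrightarrow> x \<in> carrier M \<Longrightarrow> f (a \<odot>\<^bsub>M\<^esub> x) = a \<odot>\<^bsub>N\<^esub> f x"
  using assms by (auto simp: module_hom_def)

lemma module_hom_zero:
  assumes "module A M" "module A N" "f \<in> module_hom A M N"
  shows "f \<zero>\<^bsub>M\<^esub> = \<zero>\<^bsub>N\<^esub>"
proof -
  interpret M: module A M by fact
  interpret N: module A N by fact
  have "f (\<zero>\<^bsub>A\<^esub> \<odot>\<^bsub>M\<^esub> \<zero>\<^bsub>M\<^esub>) = \<zero>\<^bsub>A\<^esub> \<odot>\<^bsub>N\<^esub> f \<zero>\<^bsub>M\<^esub>"
    by (rule module_homD(3)[OF assms(3)]) auto
  then show ?thesis
    using module_homD(1)[OF assms(3)] by simp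
qed

lemma internal_dirsumD:
  assumes "module A M" "internal_dirsum A M U V"
  shows "U \<subseteq> carrier M" "V \<subseteq> carrier M"
    and "\<And>x. x \<in> carrier M \<Longrightarrow> \<exists>u\<in>U. \<exists>v\<in>V. x = u \<oplus>\<^bsub>M\<^esub> v"
    and "\<And>u v u' v'. u \<in> U \<Longrightarrow> u' \<in> U \<Longrightarrow> v \<in> V \<Longrightarrow> v' \<in> V \<Longrightarrow>
      u \<oplus>\<^bsub>M\<^esub> v = u' \<oplus>\<^bsub>M\<^esub> v' \<Longrightarrow> u = u'"
proof -
  interpret M: module A M by fact
  have U: "submodule U A M" and V: "submodule V A M" and sum: "U <+>\<^bsub>M\<^esub> V = carrier M"
    and int: "U \<inter> V = {\<zero>\<^bsub>M\<^esub>}"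
    using assms(2) by (auto simp: internal_dirsum_def)
  show UM: "U \<subseteq> carrier M" and VM: "V \<subseteq> carrier M"
    using M.submoduleE(1) U V by blast+
  show "\<exists>u\<in>U. \<exists>v\<in>V. x = u \<oplus>\<^bsub>M\<^esub> v" if "x \<in> carrier M" for x
    using that sum unfolding set_add_def' by blast
  show "u = u'" if u: "u \<in> U" "u' \<in> U" "v \<in> V" "v' \<in> V" and eq: "u \<oplus>\<^bsub>M\<^esub> v = u' \<oplus>\<^bsub>M\<^esub> v'"
    for u v u' v'
  proof -
    have c: "u \<in> carrier M" "u' \<in> carrier M" "v \<in> carrier M" "v' \<in> carrier M"
      using u UM VM by auto
    have "u \<oplus>\<^bsub>M\<^esub> \<ominus>\<^bsub>M\<^esub> u' = (u \<oplus>\<^bsub>M\<^esub> v) \<oplus>\<^bsub>M\<^esub> \<ominus>\<^bsub>M\<^esub> v \<oplus>\<^bsub>M\<^esub> \<ominus>\<^bsub>M\<^esub> u'"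
      using c by (simp add: M.a_assoc M.r_neg)
    also have "\<dots> = v' \<oplus>\<^bsub>M\<^esub> \<ominus>\<^bsub>M\<^esub> v"
      unfolding eq using c M.a_comm[of u' v'] M.a_comm[of "\<ominus>\<^bsub>M\<^esub> v" "\<ominus>\<^bsub>M\<^esub> u'"]
      by (simp add: M.a_assoc M.r_neg2)
    finally have "u \<oplus>\<^bsub>M\<^esub> \<ominus>\<^bsub>M\<^esub> u' = v' \<oplus>\<^bsub>M\<^esub> \<ominus>\<^bsub>M\<^esub> v" .
    moreover have "u \<oplus>\<^bsub>M\<^esub> \<ominus>\<^bsub>M\<^esub> u' \<in> U" "v' \<oplus>\<^bsub>M\<^esub> \<ominus>\<^bsub>M\<^esub> v \<in> V"
      using u M.submoduleE(3,5)[OF U] M.submoduleE(3,5)[OF V] by blast+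
    ultimately have "u \<oplus>\<^bsub>M\<^esub> \<ominus>\<^bsub>M\<^esub> u' = \<zero>\<^bsub>M\<^esub>"
      using int by auto
    then show ?thesis
      using c by (metis M.minus_equality M.minus_minus M.a_inv_closed)
  qed
qed

text \<open>The retraction sends \<open>f p + v\<close>, with \<open>v\<close> in the complement, to \<open>p\<close>. Elements
  of a projective module thereby get coefficients, those of \<open>f p\<close>, through which they are studied below.\<close>

lemma summand_is_retract:
  assumes P: "module A P" and F: "module A F" and sum: "internal_dirsum A F U V"
    and iso: "module_isomorphic A P (F\<lparr>carrier := U\<rparr>)"
  obtains f g where "f \<in> module_hom A P F" "g \<in> module_hom A F P"
    "\<And>p. p \<in> carrier P \<Longrightarrow> g (f p) = p"
proof -
  interpret P: module A P by fact
  interpret F: module A F by fact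
  have V: "submodule V A F"
    using sum by (simp add: internal_dirsum_def)
  note D = internal_dirsumD[OF F sum] and VE = F.submoduleE[OF V]
  obtain f where f: "f \<in> module_hom A P (F\<lparr>carrier := U\<rparr>)" and bij: "bij_betw f (carrier P) U"
    using iso by (auto simp: module_isomorphic_def)
  have fU: "f p \<in> U" if "p \<in> carrier P" for p
    using module_homD(1)[OF f that] by simp
  have f': "f \<in> module_hom A P F"
    using f D(1) by (auto simp: module_hom_def)
  define g where "g w = (SOME p. p \<in> carrier P \<and> (\<exists>v\<in>V. w = f p \<oplus>\<^bsub>F\<^esub> v))" for w
  have g: "g (f p \<oplus>\<^bsub>F\<^esub> v) = p" if pv: "p \<in> carrier P" "v \<in> V" for p v
    unfolding g_def
  proof (rule some_equality)
    fix p' assume p': "p' \<in> carrier P \<and> (\<exists>v'\<in>V. f p \<oplus>\<^bsub>F\<^esub> v = f p' \<oplus>\<^bsub>F\<^esub> v')"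
    then have "f p = f p'"
      using D(4) fU pv by blast
    then show "p' = p"
      using p' pv bij by (metis bij_betw_def inj_onD)
  qed (use pv in auto)
  have dec: "\<exists>p\<in>carrier P. \<exists>v\<in>V. w = f p \<oplus>\<^bsub>F\<^esub> v" if "w \<in> carrier F" for w
    using D(3)[OF that] bij unfolding bij_betw_def by blast
  have "g \<in> module_hom A F P"
    unfolding module_hom_def
  proof (intro CollectI conjI ballI Pi_I)
    fix w assume w: "w \<in> carrier F"
    obtain p v where pv: "p \<in> carrier P" "v \<in> V" "w = f p \<oplus>\<^bsub>F\<^esub> v"
      using dec[OF w] by blast
    then have c: "f p \<in> carrier F" "v \<in> carrier F"
      using fU D by blast+
    show "g w \<in> carrier P"
      using pv g by simp
    show "g (a \<odot>\<^bsub>F\<^esub> w) = a \<odot>\<^bsub>P\<^esub> g w" if a: "a \<in> carrier A" for a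
    proof -
      have "a \<odot>\<^bsub>F\<^esub> w = f (a \<odot>\<^bsub>P\<^esub> p) \<oplus>\<^bsub>F\<^esub> a \<odot>\<^bsub>F\<^esub> v"
        using a pv c module_homD(3)[OF f'] by (simp add: F.smult_r_distr)
      then show ?thesis
        using a pv g VE(4) by simp
    qed
    fix w' assume w': "w' \<in> carrier F"
    obtain p' v' where pv': "p' \<in> carrier P" "v' \<in> V" "w' = f p' \<oplus>\<^bsub>F\<^esub> v'"
      using dec[OF w'] by blast
    then have c': "f p' \<in> carrier F" "v' \<in> carrier F"
      using fU D by blast+
    have "w \<oplus>\<^bsub>F\<^esub> w' = f (p \<oplus>\<^bsub>P\<^esub> p') \<oplus>\<^bsub>F\<^esub> (v \<oplus>\<^bsub>F\<^esub> v')"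
      using pv pv' c c' module_homD(2)[OF f'] by (simp add: F.a_ac)
    then show "g (w \<oplus>\<^bsub>F\<^esub> w') = g w \<oplus>\<^bsub>P\<^esub> g w'"
      using pv pv' g VE(5) by simp
  qed
  moreover have "g (f p) = p" if "p \<in> carrier P" for p
  proof -
    have "\<zero>\<^bsub>F\<^esub> \<in> V"
      using sum by (auto simp: internal_dirsum_def)
    then show ?thesis
      using g[OF that, of "\<zero>\<^bsub>F\<^esub>"] that module_homD(1)[OF f'] by simp
  qed
  ultimately show ?thesis
    using that f' by blast
qed

lemma free_module_is_module:
  assumes "cring A"
  shows "module A (free_module A B)"
proof -
  interpret cring A by fact
  let ?F = "free_module A B"
  have supp: "finite {x \<in> B. h x \<noteq> \<zero>\<^bsub>A\<^esub>}"
    if "finite {x \<in> B. f x \<noteq> \<zero>\<^bsub>A\<^esub>}" "finite {x \<in> B. g x \<noteq> \<zero>\<^bsub>A\<^esub>}"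
      "\<And>x. x \<in> B \<Longrightarrow> f x = \<zero>\<^bsub>A\<^esub> \<Longrightarrow> g x = \<zero>\<^bsub>A\<^esub> \<Longrightarrow> h x = \<zero>\<^bsub>A\<^esub>" for f g h :: "_ \<Rightarrow> 'a"
    by (rule finite_subset[OF _ finite_UnI[OF that(1,2)]]) (use that(3) in auto)
  have [simp]: "carrier ?F = {f \<in> B \<rightarrow>\<^sub>E carrier A. finite {x \<in> B. f x \<noteq> \<zero>\<^bsub>A\<^esub>}}"
    "\<zero>\<^bsub>?F\<^esub> = (\<lambda>x\<in>B. \<zero>\<^bsub>A\<^esub>)" "f \<oplus>\<^bsub>?F\<^esub> g = (\<lambda>x\<in>B. f x \<oplus>\<^bsub>A\<^esub> g x)"
    "a \<odot>\<^bsub>?F\<^esub> f = (\<lambda>x\<in>B. a \<otimes>\<^bsub>A\<^esub> f x)" for f g a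
    by (auto simp: free_module_def)
  show ?thesis
  proof (rule moduleI)
    show "abelian_group ?F"
    proof (rule abelian_groupI)
      fix f assume f: "f \<in> carrier ?F"
      have "(\<lambda>x\<in>B. \<ominus>\<^bsub>A\<^esub> f x) \<in> carrier ?F"
        using f by (auto intro!: supp[of f f] simp: PiE_iff cong: conj_cong)
      moreover have "(\<lambda>x\<in>B. \<ominus>\<^bsub>A\<^esub> f x) \<oplus>\<^bsub>?F\<^esub> f = \<zero>\<^bsub>?F\<^esub>"
        using f by (auto intro!: restrict_ext l_neg simp: PiE_iff)
      ultimately show "\<exists>g\<in>carrier ?F. g \<oplus>\<^bsub>?F\<^esub> f = \<zero>\<^bsub>?F\<^esub>" by blast
      show "\<zero>\<^bsub>?F\<^esub> \<oplus>\<^bsub>?F\<^esub> f = f"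
        using f by (intro extensionalityI[of _ B]) (auto simp: PiE_iff)
      fix g assume g: "g \<in> carrier ?F"
      show "f \<oplus>\<^bsub>?F\<^esub> g \<in> carrier ?F"
        using f g by (auto intro!: supp[of f g] simp: PiE_iff cong: conj_cong)
      show "f \<oplus>\<^bsub>?F\<^esub> g = g \<oplus>\<^bsub>?F\<^esub> f"
        using f g by (auto intro!: restrict_ext a_comm simp: PiE_iff)
      fix h assume h: "h \<in> carrier ?F"
      show "f \<oplus>\<^bsub>?F\<^esub> g \<oplus>\<^bsub>?F\<^esub> h = f \<oplus>\<^bsub>?F\<^esub> (g \<oplus>\<^bsub>?F\<^esub> h)"
        using f g h by (auto intro!: restrict_ext a_assoc simp: PiE_iff)
    qed auto
  next
    fix f assume f: "f \<in> carrier ?F"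
    show "\<one>\<^bsub>A\<^esub> \<odot>\<^bsub>?F\<^esub> f = f"
      using f by (intro extensionalityI[of _ B]) (auto simp: PiE_iff)
    fix a assume a: "a \<in> carrier A"
    show "a \<odot>\<^bsub>?F\<^esub> f \<in> carrier ?F"
      using a f by (auto intro!: supp[of f f] simp: PiE_iff cong: conj_cong)
    show "a \<odot>\<^bsub>?F\<^esub> (f \<oplus>\<^bsub>?F\<^esub> g) = a \<odot>\<^bsub>?F\<^esub> f \<oplus>\<^bsub>?F\<^esub> a \<odot>\<^bsub>?F\<^esub> g" if g: "g \<in> carrier ?F" for g
      using a f g by (auto intro!: restrict_ext r_distr simp: PiE_iff)
    fix b assume b: "b \<in> carrier A"
    show "(a \<oplus>\<^bsub>A\<^esub> b) \<odot>\<^bsub>?F\<^esub> f = a \<odot>\<^bsub>?F\<^esub> f \<oplus>\<^bsub>?F\<^esub> b \<odot>\<^bsub>?F\<^esub> f"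
      using a b f by (auto intro!: restrict_ext l_distr simp: PiE_iff)
    show "a \<otimes>\<^bsub>A\<^esub> b \<odot>\<^bsub>?F\<^esub> f = a \<odot>\<^bsub>?F\<^esub> (b \<odot>\<^bsub>?F\<^esub> f)"
      using a b f by (auto intro!: restrict_ext m_assoc simp: PiE_iff)
  qed (rule assms)
qed

lemma projective_is_module: "projective_module A P \<Longrightarrow> module A P"
  by (simp add: projective_module_def)

lemma projective_is_retract:
  fixes P :: "('a, 'm, 'd) module_scheme"
  assumes "projective_module A P"
  obtains f g and B :: "'m set" where "f \<in> module_hom A P (free_module A B)"
    "g \<in> module_hom A (free_module A B) P" "\<And>p. p \<in> carrier P \<Longrightarrow> g (f p) = p"
proof -
  have P: "module A P" by (rule projective_is_module) (rule assms)
  then have "cring A" by (simp add: module_def)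
  then show ?thesis
    using assms that summand_is_retract[OF P free_module_is_module]
    unfolding projective_module_def by metis
qed

lemma module_dirsum_simps:
  "carrier (module_dirsum M N) = carrier M \<times> carrier N"
  "\<zero>\<^bsub>module_dirsum M N\<^esub> = (\<zero>\<^bsub>M\<^esub>, \<zero>\<^bsub>N\<^esub>)"
  "(x, y) \<oplus>\<^bsub>module_dirsum M N\<^esub> (x', y') = (x \<oplus>\<^bsub>M\<^esub> x', y \<oplus>\<^bsub>N\<^esub> y')"
  "a \<odot>\<^bsub>module_dirsum M N\<^esub> (x, y) = (a \<odot>\<^bsub>M\<^esub> x, a \<odot>\<^bsub>N\<^esub> y)"
  by (simp_all add: module_dirsum_def RDirProd_def DirProd_def ring.defs module.defs monoid.defs)

lemma module_dirsum_is_module: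
  assumes "module A M" "module A N"
  shows "module A (module_dirsum M N)"
proof -
  interpret M: module A M by fact
  interpret N: module A N by fact
  show ?thesis
  proof (rule moduleI)
    show "abelian_group (module_dirsum M N)"
    proof (rule abelian_groupI)
      show "\<exists>y\<in>carrier (module_dirsum M N). y \<oplus>\<^bsub>module_dirsum M N\<^esub> x = \<zero>\<^bsub>module_dirsum M N\<^esub>"
        if "x \<in> carrier (module_dirsum M N)" for x
        using that M.l_neg N.l_neg
        by (intro bexI[of _ "(\<ominus>\<^bsub>M\<^esub> fst x, \<ominus>\<^bsub>N\<^esub> snd x)"]) (auto simp: module_dirsum_simps)
    qed (auto simp: module_dirsum_simps M.a_ac N.a_ac)
  qed (auto simp: module_dirsum_simps M.smult_l_distr N.smult_l_distr M.smult_r_distr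
      N.smult_r_distr M.smult_assoc1 N.smult_assoc1 M.is_cring)
qed

lemma quotient_module_simps:
  "carrier (quotient_module A I) = a_rcosets\<^bsub>A\<^esub> I"
  "\<zero>\<^bsub>quotient_module A I\<^esub> = I"
  "C \<oplus>\<^bsub>quotient_module A I\<^esub> C' = C <+>\<^bsub>A\<^esub> C'"
  "a \<odot>\<^bsub>quotient_module A I\<^esub> C = (I +>\<^bsub>A\<^esub> a) \<otimes>\<^bsub>A Quot I\<^esub> C"
  by (simp_all add: quotient_module_def ring.defs module.defs FactRing_def)

lemma (in ideal) quotient_module_smult:
  assumes "a \<in> carrier R" "x \<in> carrier R"
  shows "a \<odot>\<^bsub>quotient_module R I\<^esub> (I +> x) = I +> (a \<otimes> x)"
  using assms by (simp add: quotient_module_simps FactRing_def rcoset_mult_add)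

lemma (in ideal) coset_eq_iff:
  assumes "x \<in> carrier R"
  shows "I +> x = I \<longleftrightarrow> x \<in> I"
  using assms a_coset_join1 a_coset_join2 additive_subgroup_axioms
  by (metis a_rcos_self a_rcos_const)

lemma (in ideal) quotient_module_is_module:
  assumes "cring R"
  shows "module R (quotient_module R I)"
proof -
  interpret R: cring R by fact
  interpret h: ring_hom_cring R "R Quot I" "(+>) I"
    by (rule rcos_ring_hom_cring) fact
  let ?M = "quotient_module R I"
  have [simp]: "carrier ?M = carrier (R Quot I)" "\<zero>\<^bsub>?M\<^esub> = \<zero>\<^bsub>R Quot I\<^esub>"
    "add ?M = add (R Quot I)" "smult ?M = (\<lambda>a C. (I +> a) \<otimes>\<^bsub>R Quot I\<^esub> C)"
    by (simp_all add: quotient_module_def ring.defs module.defs)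
  show ?thesis
  proof (rule moduleI)
    show "abelian_group ?M"
    proof (rule abelian_groupI)
      show "\<exists>y\<in>carrier ?M. y \<oplus>\<^bsub>?M\<^esub> x = \<zero>\<^bsub>?M\<^esub>" if "x \<in> carrier ?M" for x
        using that h.S.l_neg by auto
    qed (auto simp: h.S.a_ac)
  qed (auto simp: h.S.l_distr h.S.r_distr h.S.m_assoc assms)
qed

section \<open>Atoms and their annihilator\<close>

text \<open>What the argument needs to know about the ring: the idempotents in \<open>E\<close> span ideals \<open>{0, e}\<close>,
  their common annihilator is generated by a nonzero \<open>\<kappa>\<close> of square zero, and whatever \<open>\<kappa>\<close> kills
  can be moved into that annihilator by a factor that acts as \<open>1\<close> on \<open>\<kappa>\<close>.\<close>

locale atoms_with_nilpotent_annihilator = cring A for A (structure) +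
  fixes E :: "'a set" and \<kappa> :: 'a
  assumes E_closed: "E \<subseteq> carrier A"
    and E_idem: "e \<in> E \<Longrightarrow> e \<otimes> e = e"
    and E_atom: "e \<in> E \<Longrightarrow> a \<in> carrier A \<Longrightarrow> a \<otimes> e = \<zero> \<or> a \<otimes> e = e"
    and \<kappa>_closed [simp]: "\<kappa> \<in> carrier A"
    and \<kappa>_nonzero: "\<kappa> \<noteq> \<zero>"
    and \<kappa>_square: "\<kappa> \<otimes> \<kappa> = \<zero>"
    and E_\<kappa>: "e \<in> E \<Longrightarrow> e \<otimes> \<kappa> = \<zero>"
    and E_annihilator: "a \<in> carrier A \<Longrightarrow> (\<And>e. e \<in> E \<Longrightarrow> e \<otimes> a = \<zero>) \<Longrightarrow> a \<in> PIdl \<kappa>"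
    and \<kappa>_annihilator: "a \<in> carrier A \<Longrightarrow> \<kappa> \<otimes> a = \<zero> \<Longrightarrow>
      \<exists>t\<in>carrier A. t \<otimes> \<kappa> = \<kappa> \<and> t \<otimes> a \<in> PIdl \<kappa>"
begin

lemma PIdl_\<kappa>D:
  assumes "a \<in> PIdl \<kappa>"
  shows "\<exists>c\<in>carrier A. a = \<kappa> \<otimes> c"
  using assms m_comm[OF _ \<kappa>_closed] by (force simp: cgenideal_def)

lemma atom_line:
  assumes Y: "module A Y" and e: "e \<in> E" and y: "y \<in> carrier Y" "e \<odot>\<^bsub>Y\<^esub> y = y" and a: "a \<in> carrier A"
  shows "a \<otimes> e = \<zero> \<and> a \<odot>\<^bsub>Y\<^esub> y = \<zero>\<^bsub>Y\<^esub> \<or> a \<otimes> e = e \<and> a \<odot>\<^bsub>Y\<^esub> y = y"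
proof -
  interpret Y: module A Y by fact
  have "a \<odot>\<^bsub>Y\<^esub> y = (a \<otimes> e) \<odot>\<^bsub>Y\<^esub> y"
    using y a e E_closed by (simp add: Y.smult_assoc1 subset_iff)
  then show ?thesis
    using E_atom[OF e a] y by auto
qed

lemma atom_line_double:
  assumes Y: "module A Y" and e: "e \<in> E" and y: "y \<in> carrier Y" "e \<odot>\<^bsub>Y\<^esub> y = y"
  shows "y \<oplus>\<^bsub>Y\<^esub> y = \<zero>\<^bsub>Y\<^esub>"
proof -
  interpret Y: module A Y by fact
  have "y \<oplus>\<^bsub>Y\<^esub> y = (\<one> \<oplus> \<one>) \<odot>\<^bsub>Y\<^esub> y"
    using y by (simp add: Y.smult_l_distr)
  then have "y \<oplus>\<^bsub>Y\<^esub> y = \<zero>\<^bsub>Y\<^esub> \<or> y \<oplus>\<^bsub>Y\<^esub> y = y"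
    using atom_line[OF Y e y, of "\<one> \<oplus> \<one>"] by auto
  then show ?thesis
    using y by (metis Y.add.r_cancel_one')
qed

text \<open>Since \<open>a y = (a e) y\<close>, the cyclic module \<open>A y\<close> is \<open>{0, y}\<close>; since \<open>y + y\<close> is again a multiple
  of \<open>y\<close>, it has characteristic two.\<close>

lemma atom_line_submodule:
  assumes Y: "module A Y" and e: "e \<in> E" and y: "y \<in> carrier Y" "e \<odot>\<^bsub>Y\<^esub> y = y"
  shows "submodule {\<zero>\<^bsub>Y\<^esub>, y} A Y"
proof -
  interpret Y: module A Y by fact
  have "\<ominus>\<^bsub>Y\<^esub> y = y"
    using atom_line_double[OF Y e y] y by (simp add: Y.minus_equality)
  then show ?thesis
    using atom_line[OF Y e y] atom_line_double[OF Y e y] y by (intro Y.submoduleI) auto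
qed

text \<open>The line \<open>{0, y}\<close> is a copy of \<open>A e\<close>, and \<open>A = A e \<oplus> A (1 - e)\<close> since \<open>e\<close> is idempotent. As a
  basis has to consist of elements of the type of \<open>Y\<close>, the free module of rank one is taken over \<open>{y}\<close>.\<close>

lemma atom_line_projective:
  fixes Y :: "('a, 'm, 'd) module_scheme"
  assumes Y: "module A Y" and e: "e \<in> E" and y: "y \<in> carrier Y" "e \<odot>\<^bsub>Y\<^esub> y = y" "y \<noteq> \<zero>\<^bsub>Y\<^esub>"
  shows "projective_module A (Y\<lparr>carrier := {\<zero>\<^bsub>Y\<^esub>, y}\<rparr>)"
proof -
  interpret Y: module A Y by fact
  let ?F = "free_module A {y}"
  interpret F: module A ?F by (rule free_module_is_module) (rule is_cring)
  have ec [simp]: "e \<in> carrier A" using e E_closed by auto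
  define c :: "'a \<Rightarrow> 'm \<Rightarrow> 'a" where "c a = (\<lambda>x\<in>{y}. a)" for a
  have F_carrier: "carrier ?F = c ` carrier A"
  proof
    show "carrier ?F \<subseteq> c ` carrier A"
    proof
      fix f assume "f \<in> carrier ?F"
      then have "f y \<in> carrier A" "f = c (f y)"
        by (auto simp: free_module_def c_def PiE_iff intro: extensionalityI[of _ "{y}"])
      then show "f \<in> c ` carrier A" by blast
    qed
  qed (auto simp: free_module_def c_def split: if_splits)
  have F: "\<zero>\<^bsub>?F\<^esub> = c \<zero>" "c a \<oplus>\<^bsub>?F\<^esub> c b = c (a \<oplus> b)" "a \<odot>\<^bsub>?F\<^esub> c b = c (a \<otimes> b)" for a b
    by (auto simp: free_module_def c_def intro!: restrict_ext)
  have c_inj: "c a = c b \<longleftrightarrow> a = b" for a b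
    by (metis c_def restrict_apply' singletonI)
  define U V where "U = c ` {\<zero>, e}" and "V = c ` {a \<in> carrier A. e \<otimes> a = \<zero>}"
  have minus_c: "\<ominus>\<^bsub>?F\<^esub> c a = c (\<ominus> a)" if "a \<in> carrier A" for a
    using that by (intro F.minus_equality) (auto simp: F F_carrier l_neg)
  have ee: "e \<oplus> e = \<zero>" "\<ominus> e = e"
  proof -
    have "e \<oplus> e = (\<one> \<oplus> \<one>) \<otimes> e"
      by (simp add: l_distr)
    then have "e \<oplus> e = \<zero> \<or> e \<oplus> e = e"
      using E_atom[OF e, of "\<one> \<oplus> \<one>"] by auto
    then show "e \<oplus> e = \<zero>"
      by (metis ec add.r_cancel_one' r_zero)
    then show "\<ominus> e = e"
      by (simp add: minus_equality)
  qed
  have U: "submodule U A ?F"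
    by (intro F.submoduleI) (auto simp: U_def F F_carrier minus_c ee c_inj dest: E_atom[OF e])
  have V: "submodule V A ?F"
    by (intro F.submoduleI) (auto simp: V_def F F_carrier minus_c r_distr r_minus m_lcomm)
  have sum: "c a \<in> U <+>\<^bsub>?F\<^esub> V" if a: "a \<in> carrier A" for a
  proof -
    have "c a = c (a \<otimes> e) \<oplus>\<^bsub>?F\<^esub> c (a \<ominus> a \<otimes> e)"
      using a by (simp add: F c_inj minus_eq a_lcomm r_neg)
    moreover have "c (a \<otimes> e) \<in> U"
      using E_atom[OF e a] by (auto simp: U_def)
    moreover have "c (a \<ominus> a \<otimes> e) \<in> V"
      using a E_idem[OF e] by (auto simp: V_def minus_eq r_distr r_minus m_lcomm[of e a e] m_comm[of e a] r_neg)
    ultimately show ?thesis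
      unfolding set_add_def' by blast
  qed
  have "U \<subseteq> carrier ?F" "V \<subseteq> carrier ?F"
    using F.submoduleE(1) U V by blast+
  then have "U <+>\<^bsub>?F\<^esub> V \<subseteq> carrier ?F"
    by (rule F.set_add_closed)
  moreover have "carrier ?F \<subseteq> U <+>\<^bsub>?F\<^esub> V"
    unfolding F_carrier using sum by blast
  ultimately have "U <+>\<^bsub>?F\<^esub> V = carrier ?F" ..
  moreover have "U \<inter> V = {\<zero>\<^bsub>?F\<^esub>}"
    using E_idem[OF e] by (auto simp: U_def V_def c_inj F(1))
  ultimately have "internal_dirsum A ?F U V"
    using U V by (simp add: internal_dirsum_def)
  moreover have "module_isomorphic A (Y\<lparr>carrier := {\<zero>\<^bsub>Y\<^esub>, y}\<rparr>) (?F\<lparr>carrier := U\<rparr>)"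
  proof -
    let ?f = "\<lambda>x. c (if x = y then e else \<zero>)"
    have e0: "e \<noteq> \<zero>" using y by auto
    have "?f \<in> module_hom A (Y\<lparr>carrier := {\<zero>\<^bsub>Y\<^esub>, y}\<rparr>) (?F\<lparr>carrier := U\<rparr>)"
      using y atom_line[OF Y e y(1,2)] atom_line_double[OF Y e y(1,2)]
      by (fastforce simp: module_hom_def U_def F ee c_inj)
    moreover have "bij_betw ?f {\<zero>\<^bsub>Y\<^esub>, y} U"
      using y e0 by (auto simp: bij_betw_def inj_on_def U_def c_inj)
    ultimately show ?thesis
      unfolding module_isomorphic_def by auto
  qed
  moreover have "module A (Y\<lparr>carrier := {\<zero>\<^bsub>Y\<^esub>, y}\<rparr>)"
    by (rule submodule.submodule_is_module[OF atom_line_submodule[OF Y e y(1,2)] Y])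
  ultimately show ?thesis
    unfolding projective_module_def by blast
qed

text \<open>A submodule \<open>V\<close> that is maximal among those avoiding \<open>y\<close> is a complement. If \<open>x \<notin> V\<close> then \<open>y\<close>
  lies in \<open>V + A x\<close>, and multiplying by \<open>e\<close> gives \<open>y \<in> V + e x\<close>, as \<open>a e\<close> is \<open>0\<close> or \<open>e\<close>. This
  cannot happen for \<open>x - e x\<close>, which therefore lies in \<open>V\<close>, and so \<open>x\<close> is in \<open>y + V\<close>.\<close>

lemma atom_line_summand:
  assumes Y: "module A Y" and e: "e \<in> E" and y: "y \<in> carrier Y" "e \<odot>\<^bsub>Y\<^esub> y = y" "y \<noteq> \<zero>\<^bsub>Y\<^esub>"
  shows "\<exists>V. internal_dirsum A Y {\<zero>\<^bsub>Y\<^esub>, y} V"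
proof -
  interpret Y: module A Y by fact
  have ec [simp]: "e \<in> carrier A" using e E_closed by auto
  define \<A> where "\<A> = {V. submodule V A Y \<and> y \<notin> V}"
  have "{\<zero>\<^bsub>Y\<^esub>} \<in> \<A>"
    using y by (auto simp: \<A>_def intro!: Y.submoduleI)
  moreover have "\<Union>\<C> \<in> \<A>" if \<C>: "\<C> \<noteq> {}" "subset.chain \<A> \<C>" for \<C>
  proof -
    have sub: "submodule V A Y" "y \<notin> V" if "V \<in> \<C>" for V
      using \<C> that by (auto simp: subset_chain_def \<A>_def)
    note subE = Y.submoduleE[OF sub(1)]
    have "submodule (\<Union>\<C>) A Y"
    proof (rule Y.submoduleI)
      obtain V where V: "V \<in> \<C>" using \<C> by blast
      show "\<zero>\<^bsub>Y\<^esub> \<in> \<Union>\<C>"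
        using subgroup.one_closed[OF submodule.axioms(1)[OF sub(1)[OF V]]] V by auto
      fix v w assume "v \<in> \<Union>\<C>" "w \<in> \<Union>\<C>"
      then obtain V W where VW: "v \<in> V" "V \<in> \<C>" "w \<in> W" "W \<in> \<C>" by blast
      then have "V \<subseteq> W \<or> W \<subseteq> V"
        using \<C> by (auto simp: subset_chain_def)
      then show "v \<oplus>\<^bsub>Y\<^esub> w \<in> \<Union>\<C>"
        using VW subE(5) by blast
    qed (use subE(1,3,4) in blast)+
    then show ?thesis
      using sub(2) by (auto simp: \<A>_def)
  qed
  ultimately obtain V where "V \<in> \<A>" and max: "\<And>W. W \<in> \<A> \<Longrightarrow> V \<subseteq> W \<Longrightarrow> W = V"
    using subset_Zorn_nonempty[of \<A>] by blast
  then have V: "submodule V A Y" "y \<notin> V"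
    by (auto simp: \<A>_def)
  note VE = Y.submoduleE[OF V(1)]
  have V0: "\<zero>\<^bsub>Y\<^esub> \<in> V"
    using subgroup.one_closed[OF submodule.axioms(1)[OF V(1)]] by simp
  have step: "\<exists>v\<in>V. y = v \<oplus>\<^bsub>Y\<^esub> e \<odot>\<^bsub>Y\<^esub> x" if x: "x \<in> carrier Y" "x \<notin> V" for x
  proof -
    define W where "W = {v \<oplus>\<^bsub>Y\<^esub> a \<odot>\<^bsub>Y\<^esub> x | v a. v \<in> V \<and> a \<in> carrier A}"
    have WI: "w \<in> W" if "v \<in> V" "a \<in> carrier A" "w = v \<oplus>\<^bsub>Y\<^esub> a \<odot>\<^bsub>Y\<^esub> x" for w v a
      using that by (auto simp: W_def)
    have "submodule W A Y"
    proof (rule Y.submoduleI)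
      show "W \<subseteq> carrier Y"
        using VE(1) x by (auto simp: W_def)
      show "\<zero>\<^bsub>Y\<^esub> \<in> W"
        using V0 x by (intro WI[of "\<zero>\<^bsub>Y\<^esub>" \<zero>]) auto
      fix w assume "w \<in> W"
      then obtain v a where w: "v \<in> V" "a \<in> carrier A" "w = v \<oplus>\<^bsub>Y\<^esub> a \<odot>\<^bsub>Y\<^esub> x"
        by (auto simp: W_def)
      have vc: "v \<in> carrier Y" using w VE(1) by auto
      show "\<ominus>\<^bsub>Y\<^esub> w \<in> W"
        using w vc x VE(3) by (intro WI[of "\<ominus>\<^bsub>Y\<^esub> v" "\<ominus> a"]) (auto simp: Y.smult_l_minus Y.minus_add)
      show "b \<odot>\<^bsub>Y\<^esub> w \<in> W" if "b \<in> carrier A" for b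
        using w vc x VE(4) that
        by (intro WI[of "b \<odot>\<^bsub>Y\<^esub> v" "b \<otimes> a"]) (auto simp: Y.smult_assoc1 Y.smult_r_distr)
      fix w' assume "w' \<in> W"
      then obtain v' a' where w': "v' \<in> V" "a' \<in> carrier A" "w' = v' \<oplus>\<^bsub>Y\<^esub> a' \<odot>\<^bsub>Y\<^esub> x"
        by (auto simp: W_def)
      have vc': "v' \<in> carrier Y" using w' VE(1) by auto
      show "w \<oplus>\<^bsub>Y\<^esub> w' \<in> W"
        using w w' vc vc' x VE(5)
        by (intro WI[of "v \<oplus>\<^bsub>Y\<^esub> v'" "a \<oplus> a'"]) (auto simp: Y.smult_l_distr Y.a_ac)
    qed
    moreover have "V \<subseteq> W"
    proof
      fix v assume "v \<in> V"
      then show "v \<in> W"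
        using VE(1) x by (intro WI[of v \<zero>]) auto
    qed
    moreover have "x \<in> W"
      using V0 x by (intro WI[of "\<zero>\<^bsub>Y\<^esub>" \<one>]) auto
    ultimately have "y \<in> W"
      using max[of W] x by (auto simp: \<A>_def)
    then obtain v a where v: "v \<in> V" "a \<in> carrier A" "y = v \<oplus>\<^bsub>Y\<^esub> a \<odot>\<^bsub>Y\<^esub> x"
      by (auto simp: W_def)
    have vc: "v \<in> carrier Y" using v VE(1) by auto
    have "y = e \<odot>\<^bsub>Y\<^esub> y" using y by simp
    also have "\<dots> = e \<odot>\<^bsub>Y\<^esub> v \<oplus>\<^bsub>Y\<^esub> (a \<otimes> e) \<odot>\<^bsub>Y\<^esub> x"
      using v vc x by (simp add: Y.smult_r_distr Y.smult_assoc1[symmetric] m_comm)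
    finally have *: "y = e \<odot>\<^bsub>Y\<^esub> v \<oplus>\<^bsub>Y\<^esub> (a \<otimes> e) \<odot>\<^bsub>Y\<^esub> x" .
    have ev: "e \<odot>\<^bsub>Y\<^esub> v \<in> V"
      using VE(4) v by simp
    then have "a \<otimes> e \<noteq> \<zero>"
      using * V(2) vc x by auto
    then have "a \<otimes> e = e"
      using E_atom[OF e v(2)] by auto
    then show ?thesis
      using * ev by auto
  qed
  have "x \<in> {\<zero>\<^bsub>Y\<^esub>, y} <+>\<^bsub>Y\<^esub> V" if x: "x \<in> carrier Y" for x
  proof (cases "x \<in> V")
    case True
    then show ?thesis
      using x unfolding set_add_def' by force
  next
    case False
    define z where "z = x \<oplus>\<^bsub>Y\<^esub> \<ominus>\<^bsub>Y\<^esub> (e \<odot>\<^bsub>Y\<^esub> x)"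
    have zc: "z \<in> carrier Y" using x by (simp add: z_def)
    have "e \<odot>\<^bsub>Y\<^esub> z = \<zero>\<^bsub>Y\<^esub>"
      using x E_idem[OF e]
      by (simp add: z_def Y.smult_r_distr Y.smult_r_minus Y.smult_assoc1[symmetric] Y.r_neg)
    then have zV: "z \<in> V"
      using step[OF zc] V(2) VE(1) by force
    obtain v where v: "v \<in> V" "y = v \<oplus>\<^bsub>Y\<^esub> e \<odot>\<^bsub>Y\<^esub> x"
      using step[OF x False] by blast
    have vc: "v \<in> carrier Y" using v VE(1) by auto
    have "x = y \<oplus>\<^bsub>Y\<^esub> (\<ominus>\<^bsub>Y\<^esub> v \<oplus>\<^bsub>Y\<^esub> z)"
    proof -
      have "y \<oplus>\<^bsub>Y\<^esub> (\<ominus>\<^bsub>Y\<^esub> v \<oplus>\<^bsub>Y\<^esub> z) = e \<odot>\<^bsub>Y\<^esub> x \<oplus>\<^bsub>Y\<^esub> z"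
        unfolding v(2) using vc x zc by (simp add: Y.a_assoc Y.a_comm[of v] Y.r_neg2)
      also have "\<dots> = x"
        unfolding z_def using x by (simp add: Y.a_lcomm Y.r_neg)
      finally show ?thesis by simp
    qed
    moreover have "\<ominus>\<^bsub>Y\<^esub> v \<oplus>\<^bsub>Y\<^esub> z \<in> V"
      using VE(3,5) v zV by blast
    ultimately show ?thesis
      unfolding set_add_def' by blast
  qed
  moreover have "{\<zero>\<^bsub>Y\<^esub>, y} <+>\<^bsub>Y\<^esub> V \<subseteq> carrier Y"
    using y VE(1) by (intro Y.set_add_closed) auto
  ultimately have "internal_dirsum A Y {\<zero>\<^bsub>Y\<^esub>, y} V"
    using V V0 atom_line_submodule[OF Y e y(1,2)] unfolding internal_dirsum_def by blast
  then show ?thesis by blast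
qed

text \<open>Otherwise \<open>{0, e x}\<close> is a nonzero projective summand.\<close>

lemma stable_killed_by_atoms:
  assumes "stable_module A Y" and e: "e \<in> E" and x: "x \<in> carrier Y"
  shows "e \<odot>\<^bsub>Y\<^esub> x = \<zero>\<^bsub>Y\<^esub>"
proof (rule ccontr)
  assume nz: "e \<odot>\<^bsub>Y\<^esub> x \<noteq> \<zero>\<^bsub>Y\<^esub>"
  have Y: "module A Y" using assms by (simp add: stable_module_def)
  interpret Y: module A Y by fact
  have ec: "e \<in> carrier A" using e E_closed by auto
  let ?y = "e \<odot>\<^bsub>Y\<^esub> x"
  have y: "?y \<in> carrier Y" "e \<odot>\<^bsub>Y\<^esub> ?y = ?y"
    using ec x E_idem[OF e] by (simp_all flip: Y.smult_assoc1)
  show False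
    using atom_line_summand[OF Y e y nz] atom_line_projective[OF Y e y nz] assms(1) nz
    unfolding stable_module_def by blast
qed

lemma free_divisible_by_\<kappa>:
  assumes u: "u \<in> carrier (free_module A B)" and coeff: "\<And>x. x \<in> B \<Longrightarrow> u x \<in> PIdl \<kappa>"
  shows "\<exists>w\<in>carrier (free_module A B). u = \<kappa> \<odot>\<^bsub>free_module A B\<^esub> w"
proof -
  obtain d where d: "\<And>x. x \<in> B \<Longrightarrow> d x \<in> carrier A \<and> u x = \<kappa> \<otimes> d x"
    using PIdl_\<kappa>D[OF coeff] by metis
  \<comment> \<open>a quotient of \<open>0\<close> by \<open>\<kappa>\<close> need not be \<open>0\<close>, so it is chosen as \<open>0\<close> to keep the support finite\<close>
  let ?w = "\<lambda>x\<in>B. if u x = \<zero> then \<zero> else d x"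
  have fin: "finite {x \<in> B. u x \<noteq> \<zero>}" and ext: "u \<in> B \<rightarrow>\<^sub>E carrier A"
    using u by (auto simp: free_module_def)
  have "finite {x \<in> B. ?w x \<noteq> \<zero>}"
    by (rule finite_subset[OF _ fin]) auto
  then have "?w \<in> carrier (free_module A B)"
    using d by (auto simp: free_module_def)
  moreover have "u = \<kappa> \<odot>\<^bsub>free_module A B\<^esub> ?w"
    using ext d by (intro extensionalityI[of _ B]) (auto simp: free_module_def PiE_iff)
  ultimately show ?thesis by blast
qed

text \<open>Divide the coefficients of \<open>f p\<close> by \<open>\<kappa>\<close> in the free module and retract.\<close>

lemma projective_divisible_by_\<kappa>:
  fixes P :: "('a, 'm, 'd) module_scheme"
  assumes "f \<in> module_hom A P (free_module A (B :: 'm set))"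
    "g \<in> module_hom A (free_module A B) P" "\<And>p. p \<in> carrier P \<Longrightarrow> g (f p) = p"
    and p: "p \<in> carrier P" and coeff: "\<And>x. x \<in> B \<Longrightarrow> f p x \<in> PIdl \<kappa>"
  shows "\<exists>p'\<in>carrier P. p = \<kappa> \<odot>\<^bsub>P\<^esub> p'"
proof -
  obtain w where w: "w \<in> carrier (free_module A B)" "f p = \<kappa> \<odot>\<^bsub>free_module A B\<^esub> w"
    using free_divisible_by_\<kappa>[of "f p" B] coeff module_homD(1)[OF assms(1) p] by blast
  then have "p = \<kappa> \<odot>\<^bsub>P\<^esub> g w"
    using assms(3)[OF p] module_homD(3)[OF assms(2), of \<kappa> w] by simp
  then show ?thesis
    using module_homD(1)[OF assms(2) w(1)] by blast
qed

lemma projective_atom_torsion: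
  fixes P :: "('a, 'm, 'd) module_scheme"
  assumes P: "projective_module A P" and p: "p \<in> carrier P"
    and tors: "\<And>e. e \<in> E \<Longrightarrow> e \<odot>\<^bsub>P\<^esub> p = \<zero>\<^bsub>P\<^esub>"
  shows "\<exists>p'\<in>carrier P. p = \<kappa> \<odot>\<^bsub>P\<^esub> p'"
proof -
  obtain f g and B :: "'m set" where fg: "f \<in> module_hom A P (free_module A B)"
    "g \<in> module_hom A (free_module A B) P" "\<And>p. p \<in> carrier P \<Longrightarrow> g (f p) = p"
    by (rule projective_is_retract[OF P]) (rule that)
  have f0: "f \<zero>\<^bsub>P\<^esub> = (\<lambda>x\<in>B. \<zero>)"
    using module_hom_zero[OF projective_is_module[OF P] free_module_is_module[OF is_cring] fg(1)]
    by (simp add: free_module_def)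
  have fp: "f p x \<in> carrier A" if "x \<in> B" for x
    using module_homD(1)[OF fg(1) p] that by (auto simp: free_module_def)
  show ?thesis
  proof (rule projective_divisible_by_\<kappa>[OF fg p])
    fix x assume x: "x \<in> B"
    show "f p x \<in> PIdl \<kappa>"
    proof (rule E_annihilator[OF fp[OF x]])
      fix e assume e: "e \<in> E"
      have "(\<lambda>x\<in>B. e \<otimes> f p x) = (\<lambda>x\<in>B. \<zero>)"
        using module_homD(3)[OF fg(1) _ p, of e] tors[OF e] f0 e E_closed by (auto simp: free_module_def)
      then show "e \<otimes> f p x = \<zero>"
        using x by (metis restrict_apply')
    qed
  qed
qed

text \<open>The factors belonging to the individual elements can be multiplied together, since each of
  them fixes \<open>\<kappa>\<close> and \<open>A \<kappa>\<close> is an ideal.\<close>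

lemma common_multiplier:
  assumes "finite B" "\<And>x. x \<in> B \<Longrightarrow> u x \<in> carrier A \<and> \<kappa> \<otimes> u x = \<zero>"
  shows "\<exists>t\<in>carrier A. t \<otimes> \<kappa> = \<kappa> \<and> (\<forall>x\<in>B. t \<otimes> u x \<in> PIdl \<kappa>)"
  using assms
proof (induction B rule: finite_induct)
  case empty
  then show ?case by (intro bexI[of _ \<one>]) auto
next
  case (insert b B)
  interpret I: ideal "PIdl \<kappa>" A by (rule cgenideal_ideal) simp
  obtain t where t: "t \<in> carrier A" "t \<otimes> \<kappa> = \<kappa>" "\<forall>x\<in>B. t \<otimes> u x \<in> PIdl \<kappa>"
    using insert by auto
  obtain s where s: "s \<in> carrier A" "s \<otimes> \<kappa> = \<kappa>" "s \<otimes> u b \<in> PIdl \<kappa>"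
    using \<kappa>_annihilator[of "u b"] insert.prems by auto
  have "s \<otimes> t \<otimes> \<kappa> = \<kappa>"
    using s t by (simp add: m_assoc)
  moreover have "s \<otimes> t \<otimes> u x \<in> PIdl \<kappa>" if "x \<in> insert b B" for x
  proof (cases "x = b")
    case True
    then show ?thesis
      using s t insert.prems[of b] I.I_l_closed[OF s(3) t(1)] by (simp add: m_ac)
  next
    case False
    then show ?thesis
      using that s t insert.prems[of x] I.I_l_closed[of "t \<otimes> u x" s] by (simp add: m_assoc)
  qed
  ultimately show ?case
    using s t by blast
qed

text \<open>Only finitely many coefficients are nonzero, so one factor \<open>t\<close> serves for all of them.\<close>

lemma projective_\<kappa>_torsion:
  fixes P :: "('a, 'm, 'd) module_scheme"
  assumes P: "projective_module A P" and p: "p \<in> carrier P" and tors: "\<kappa> \<odot>\<^bsub>P\<^esub> p = \<zero>\<^bsub>P\<^esub>"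
  shows "\<exists>t\<in>carrier A. t \<otimes> \<kappa> = \<kappa> \<and> (\<exists>p'\<in>carrier P. t \<odot>\<^bsub>P\<^esub> p = \<kappa> \<odot>\<^bsub>P\<^esub> p')"
proof -
  obtain f g and B :: "'m set" where fg: "f \<in> module_hom A P (free_module A B)"
    "g \<in> module_hom A (free_module A B) P" "\<And>p. p \<in> carrier P \<Longrightarrow> g (f p) = p"
    by (rule projective_is_retract[OF P]) (rule that)
  interpret P: module A P by (rule projective_is_module) (rule P)
  have f0: "f \<zero>\<^bsub>P\<^esub> = (\<lambda>x\<in>B. \<zero>)"
    using module_hom_zero[OF projective_is_module[OF P] free_module_is_module[OF is_cring] fg(1)]
    by (simp add: free_module_def)
  have fp: "f p x \<in> carrier A" if "x \<in> B" for x
    using module_homD(1)[OF fg(1) p] that by (auto simp: free_module_def)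
  have "(\<lambda>x\<in>B. \<kappa> \<otimes> f p x) = (\<lambda>x\<in>B. \<zero>)"
    using module_homD(3)[OF fg(1) _ p, of \<kappa>] tors f0 by (auto simp: free_module_def)
  then have k: "\<kappa> \<otimes> f p x = \<zero>" if "x \<in> B" for x
    using that by (metis restrict_apply')
  have "finite {x \<in> B. f p x \<noteq> \<zero>}"
    using module_homD(1)[OF fg(1) p] by (auto simp: free_module_def)
  then obtain t where t: "t \<in> carrier A" "t \<otimes> \<kappa> = \<kappa>"
    "\<forall>x\<in>{x \<in> B. f p x \<noteq> \<zero>}. t \<otimes> f p x \<in> PIdl \<kappa>"
    using common_multiplier[of "{x \<in> B. f p x \<noteq> \<zero>}" "f p"] fp k by auto
  interpret I: ideal "PIdl \<kappa>" A by (rule cgenideal_ideal) simp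
  have "\<exists>p'\<in>carrier P. t \<odot>\<^bsub>P\<^esub> p = \<kappa> \<odot>\<^bsub>P\<^esub> p'"
  proof (rule projective_divisible_by_\<kappa>[OF fg])
    show "t \<odot>\<^bsub>P\<^esub> p \<in> carrier P" using t p by simp
    fix x assume x: "x \<in> B"
    have "f (t \<odot>\<^bsub>P\<^esub> p) x = t \<otimes> f p x"
      using x module_homD(3)[OF fg(1) t(1) p] by (simp add: free_module_def)
    then show "f (t \<odot>\<^bsub>P\<^esub> p) x \<in> PIdl \<kappa>"
      using t x by (cases "f p x = \<zero>") auto
  qed
  then show ?thesis using t by blast
qed

section \<open>The quotient by the annihilator of the atoms\<close>

abbreviation "M \<equiv> quotient_module A (PIdl \<kappa>)"

lemma M_module: "module A M"
  by (rule ideal.quotient_module_is_module[OF cgenideal_ideal]) (simp_all add: is_cring)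

lemma M_elem:
  assumes "m \<in> carrier M"
  obtains x where "x \<in> carrier A" "m = PIdl \<kappa> +> x"
  using assms by (auto simp: quotient_module_simps A_RCOSETS_def' )

lemma M_coset: "x \<in> carrier A \<Longrightarrow> PIdl \<kappa> +> x \<in> carrier M"
  by (auto simp: quotient_module_simps A_RCOSETS_def')

lemma M_smult:
  assumes "a \<in> carrier A" "x \<in> carrier A"
  shows "a \<odot>\<^bsub>M\<^esub> (PIdl \<kappa> +> x) = PIdl \<kappa> +> (a \<otimes> x)"
  by (rule ideal.quotient_module_smult[OF cgenideal_ideal]) (use assms in auto)

lemma M_zero_iff: "x \<in> carrier A \<Longrightarrow> PIdl \<kappa> +> x = \<zero>\<^bsub>M\<^esub> \<longleftrightarrow> x \<in> PIdl \<kappa>"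
  by (simp add: quotient_module_simps ideal.coset_eq_iff[OF cgenideal_ideal])

lemma M_killed_by_\<kappa>:
  assumes "m \<in> carrier M"
  shows "\<kappa> \<odot>\<^bsub>M\<^esub> m = \<zero>\<^bsub>M\<^esub>"
proof -
  obtain x where x: "x \<in> carrier A" "m = PIdl \<kappa> +> x"
    using M_elem[OF assms] .
  have "\<kappa> \<otimes> x \<in> PIdl \<kappa>"
    using x ideal.I_r_closed[OF cgenideal_ideal cgenideal_self] by simp
  then show ?thesis
    using x by (simp add: M_smult M_zero_iff)
qed

text \<open>If \<open>e x \<in> A \<kappa>\<close> then \<open>e x = e (e x) \<in> A e \<kappa> = 0\<close>; if this holds for all atoms, \<open>x\<close> is in their
  common annihilator \<open>A \<kappa>\<close>.\<close>

lemma M_atom_torsion_free: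
  assumes m: "m \<in> carrier M" and tors: "\<And>e. e \<in> E \<Longrightarrow> e \<odot>\<^bsub>M\<^esub> m = \<zero>\<^bsub>M\<^esub>"
  shows "m = \<zero>\<^bsub>M\<^esub>"
proof -
  obtain x where x: "x \<in> carrier A" "m = PIdl \<kappa> +> x"
    using M_elem[OF m] .
  have "x \<in> PIdl \<kappa>"
  proof (rule E_annihilator[OF x(1)])
    fix e assume e: "e \<in> E"
    have ec: "e \<in> carrier A" using e E_closed by auto
    have "e \<otimes> x \<in> PIdl \<kappa>"
      using tors[OF e] x ec by (simp add: M_smult M_zero_iff)
    then obtain c where c: "c \<in> carrier A" "e \<otimes> x = \<kappa> \<otimes> c"
      using PIdl_\<kappa>D by blast
    have "e \<otimes> x = e \<otimes> (e \<otimes> x)"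
      using E_idem[OF e] ec x by (simp flip: m_assoc)
    also have "\<dots> = \<zero>"
      unfolding c(2) using c(1) ec E_\<kappa>[OF e] by (simp flip: m_assoc)
    finally show "e \<otimes> x = \<zero>" .
  qed
  then show ?thesis
    using x by (simp add: M_zero_iff)
qed

text \<open>Otherwise \<open>t \<in> A \<kappa>\<close>, and \<open>\<kappa> = t \<kappa>\<close> would be a multiple of \<open>\<kappa>\<^sup>2 = 0\<close>.\<close>

lemma M_generator:
  assumes t: "t \<in> carrier A" "t \<otimes> \<kappa> = \<kappa>"
  shows "t \<odot>\<^bsub>M\<^esub> (PIdl \<kappa> +> \<one>) \<noteq> \<zero>\<^bsub>M\<^esub>"
proof
  assume "t \<odot>\<^bsub>M\<^esub> (PIdl \<kappa> +> \<one>) = \<zero>\<^bsub>M\<^esub>"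
  then obtain c where c: "c \<in> carrier A" "t = \<kappa> \<otimes> c"
    using t PIdl_\<kappa>D by (auto simp: M_smult M_zero_iff)
  have "\<kappa> = t \<otimes> \<kappa>" using t by simp
  also have "\<dots> = \<kappa> \<otimes> \<kappa> \<otimes> c"
    unfolding c(2) using c(1) by (simp add: m_ac)
  also have "\<dots> = \<zero>"
    using c(1) by (simp add: \<kappa>_square)
  finally show False
    using \<kappa>_nonzero by simp
qed

lemma M_cyclically_presented: "cyclically_presented A M"
proof -
  interpret M: module A M by (rule M_module)
  have "id \<in> module_hom A M M"
    by (auto simp: module_hom_def)
  then have "module_isomorphic A M M"
    unfolding module_isomorphic_def by (metis bij_betw_id)
  then show ?thesis
    using M_module cgenideal_is_principalideal[OF \<kappa>_closed]
    unfolding cyclically_presented_def by blast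
qed

lemma M_not_projective: "\<not> projective_module A M"
proof
  assume "projective_module A M"
  then obtain t m where "t \<in> carrier A" "t \<otimes> \<kappa> = \<kappa>" "m \<in> carrier M"
      "t \<odot>\<^bsub>M\<^esub> (PIdl \<kappa> +> \<one>) = \<kappa> \<odot>\<^bsub>M\<^esub> m"
    using projective_\<kappa>_torsion[of M "PIdl \<kappa> +> \<one>"] M_coset M_killed_by_\<kappa> by blast
  then show False
    using M_generator M_killed_by_\<kappa> by simp
qed

lemma M_no_stable_submodule:
  assumes "submodule N A M" and "stable_module A (M\<lparr>carrier := N\<rparr>)"
  shows "N = {\<zero>\<^bsub>M\<^esub>}"
proof -
  interpret M: module A M by (rule M_module)
  have N: "N \<subseteq> carrier M"
    using M.submoduleE(1)[OF assms(1)] .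
  have "n = \<zero>\<^bsub>M\<^esub>" if "n \<in> N" for n
  proof (rule M_atom_torsion_free)
    show "n \<in> carrier M" using N that by blast
    show "e \<odot>\<^bsub>M\<^esub> n = \<zero>\<^bsub>M\<^esub>" if "e \<in> E" for e
      using stable_killed_by_atoms[OF assms(2) that, of n] \<open>n \<in> N\<close> by simp
  qed
  moreover have "\<zero>\<^bsub>M\<^esub> \<in> N"
    using subgroup.one_closed[OF submodule.axioms(1)[OF assms(1)]] by simp
  ultimately show ?thesis by blast
qed

lemma M_no_projective_stable_decomposition:
  assumes sum: "internal_dirsum A M P N" and P: "projective_module A (M\<lparr>carrier := P\<rparr>)"
    and N: "stable_module A (M\<lparr>carrier := N\<rparr>)"
  shows False
proof -
  interpret M: module A M by (rule M_module)
  have N0: "N = {\<zero>\<^bsub>M\<^esub>}"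
    using sum N by (intro M_no_stable_submodule) (simp_all add: internal_dirsum_def)
  note D = internal_dirsumD(1,3)[OF M_module sum]
  have "x \<in> P" if x: "x \<in> carrier M" for x
  proof -
    obtain u where "u \<in> P" "x = u \<oplus>\<^bsub>M\<^esub> \<zero>\<^bsub>M\<^esub>"
      using D(2)[OF x] N0 by blast
    then show ?thesis
      using D(1) by (simp add: subset_iff)
  qed
  then have "P = carrier M"
    using D(1) by blast
  then show False
    using P M_not_projective by simp
qed

text \<open>Torsion with respect to the atoms forces \<open>Y = \<kappa> Y\<close>, hence \<open>Y = 0\<close>; then the generator of \<open>M\<close>
  maps into \<open>Q\<close>, where elements killed by \<open>\<kappa>\<close> behave differently than in \<open>M\<close>.\<close>

lemma M_not_projectively_equivalent_to_stable:
  fixes Y :: "('a, 'y, 'd) module_scheme"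
  assumes stable: "stable_module A Y"
  shows "\<not> projectively_equivalent TYPE('p) TYPE('q) A M Y"
proof
  assume "projectively_equivalent TYPE('p) TYPE('q) A M Y"
  then have "\<exists>(P :: ('a, 'p) module) (Q :: ('a, 'q) module). projective_module A P \<and>
      projective_module A Q \<and> module_isomorphic A (module_dirsum M P) (module_dirsum Y Q)"
    unfolding projectively_equivalent_def by (elim conjE)
  then obtain P :: "('a, 'p) module" and Q :: "('a, 'q) module"
    where P: "projective_module A P" and Q: "projective_module A Q"
      and iso: "module_isomorphic A (module_dirsum M P) (module_dirsum Y Q)"
    by (elim exE conjE)
  obtain \<phi> where \<phi>: "\<phi> \<in> module_hom A (module_dirsum M P) (module_dirsum Y Q)"
      and bij: "bij_betw \<phi> (carrier M \<times> carrier P) (carrier Y \<times> carrier Q)"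
    using iso unfolding module_isomorphic_def module_dirsum_simps by (elim bexE)
  have Y: "module A Y"
    using stable by (simp add: stable_module_def)
  have PQ: "module A P" "module A Q"
    by (rule projective_is_module; rule P Q)+
  interpret M: module A M by (rule M_module)
  interpret Y: module A Y by fact
  interpret P: module A P by fact
  interpret Q: module A Q by fact
  note sumM = module_dirsum_is_module[OF M_module PQ(1)]
    and sumY = module_dirsum_is_module[OF Y PQ(2)]
  have \<phi>_closed: "\<phi> (m, p) \<in> carrier Y \<times> carrier Q" if "m \<in> carrier M" "p \<in> carrier P" for m p
    using module_homD(1)[OF \<phi>, of "(m, p)"] that by (auto simp: module_dirsum_simps)
  have \<phi>_smult: "\<phi> (a \<odot>\<^bsub>M\<^esub> m, a \<odot>\<^bsub>P\<^esub> p) = (a \<odot>\<^bsub>Y\<^esub> fst (\<phi> (m, p)), a \<odot>\<^bsub>Q\<^esub> snd (\<phi> (m, p)))"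
    if "a \<in> carrier A" "m \<in> carrier M" "p \<in> carrier P" for a m p
    using module_homD(3)[OF \<phi> that(1), of "(m, p)"] that
    by (cases "\<phi> (m, p)") (simp add: module_dirsum_simps)
  have \<phi>_zero: "\<phi> (\<zero>\<^bsub>M\<^esub>, \<zero>\<^bsub>P\<^esub>) = (\<zero>\<^bsub>Y\<^esub>, \<zero>\<^bsub>Q\<^esub>)"
    using module_hom_zero[OF sumM sumY \<phi>] by (simp add: module_dirsum_simps)
  have \<phi>_inj: "m = m' \<and> p = p'"
    if "\<phi> (m, p) = \<phi> (m', p')" "m \<in> carrier M" "p \<in> carrier P" "m' \<in> carrier M" "p' \<in> carrier P"
    for m p m' p'
    using inj_onD[OF bij_betw_imp_inj_on[OF bij] that(1)] that(2-5) by simp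
  have \<phi>_surj: "\<exists>m\<in>carrier M. \<exists>p\<in>carrier P. \<phi> (m, p) = (y, q)"
    if "y \<in> carrier Y" "q \<in> carrier Q" for y q
  proof -
    have "(y, q) \<in> \<phi> ` (carrier M \<times> carrier P)"
      using bij that by (simp add: bij_betw_def)
    then obtain m p where "m \<in> carrier M" "p \<in> carrier P" "(y, q) = \<phi> (m, p)"
      by (elim imageE SigmaE) simp
    then show ?thesis by (metis (no_types))
  qed
  have divisible: "\<exists>y'\<in>carrier Y. y = \<kappa> \<odot>\<^bsub>Y\<^esub> y'" if y: "y \<in> carrier Y" for y
  proof -
    obtain m p where mp: "m \<in> carrier M" "p \<in> carrier P" "\<phi> (m, p) = (y, \<zero>\<^bsub>Q\<^esub>)"
      using \<phi>_surj[OF y Q.zero_closed] by blast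
    have tors: "e \<odot>\<^bsub>M\<^esub> m = \<zero>\<^bsub>M\<^esub> \<and> e \<odot>\<^bsub>P\<^esub> p = \<zero>\<^bsub>P\<^esub>" if e: "e \<in> E" for e
    proof (rule \<phi>_inj)
      have ec: "e \<in> carrier A" using e E_closed by auto
      show "\<phi> (e \<odot>\<^bsub>M\<^esub> m, e \<odot>\<^bsub>P\<^esub> p) = \<phi> (\<zero>\<^bsub>M\<^esub>, \<zero>\<^bsub>P\<^esub>)"
        using \<phi>_smult[OF ec mp(1,2)] mp(3) stable_killed_by_atoms[OF stable e y] ec
        by (simp add: \<phi>_zero)
      show "e \<odot>\<^bsub>M\<^esub> m \<in> carrier M" "e \<odot>\<^bsub>P\<^esub> p \<in> carrier P"
        using ec mp by auto
    qed auto
    have m0: "m = \<zero>\<^bsub>M\<^esub>"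
      using M_atom_torsion_free mp tors by blast
    obtain p' where p': "p' \<in> carrier P" "p = \<kappa> \<odot>\<^bsub>P\<^esub> p'"
      using projective_atom_torsion[OF P mp(2)] tors by blast
    have "y = \<kappa> \<odot>\<^bsub>Y\<^esub> fst (\<phi> (\<zero>\<^bsub>M\<^esub>, p'))"
      using \<phi>_smult[OF \<kappa>_closed M.zero_closed p'(1)] mp(3) by (simp add: m0 p')
    then show ?thesis
      using \<phi>_closed[OF M.zero_closed p'(1)] by (auto simp: mem_Times_iff)
  qed
  have Y0: "y = \<zero>\<^bsub>Y\<^esub>" if y: "y \<in> carrier Y" for y
  proof -
    obtain y' where y': "y' \<in> carrier Y" "y = \<kappa> \<odot>\<^bsub>Y\<^esub> y'" using divisible[OF y] by blast
    obtain y'' where y'': "y'' \<in> carrier Y" "y' = \<kappa> \<odot>\<^bsub>Y\<^esub> y''" using divisible[OF y'(1)] by blast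
    show ?thesis
      unfolding y'(2) y''(2) using y''(1) \<kappa>_square by (simp flip: Y.smult_assoc1)
  qed
  let ?g = "PIdl \<kappa> +> \<one>"
  have g: "?g \<in> carrier M" by (simp add: M_coset)
  obtain y q where yq: "\<phi> (?g, \<zero>\<^bsub>P\<^esub>) = (y, q)" by fastforce
  then have q: "q \<in> carrier Q" and y0: "y = \<zero>\<^bsub>Y\<^esub>"
    using \<phi>_closed[OF g P.zero_closed] Y0 by auto
  have "\<kappa> \<odot>\<^bsub>Q\<^esub> q = \<zero>\<^bsub>Q\<^esub>"
    using \<phi>_smult[OF \<kappa>_closed g P.zero_closed] M_killed_by_\<kappa>[OF g] by (simp add: yq \<phi>_zero)
  then obtain t q' where t: "t \<in> carrier A" "t \<otimes> \<kappa> = \<kappa>" and q': "q' \<in> carrier Q"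
    "t \<odot>\<^bsub>Q\<^esub> q = \<kappa> \<odot>\<^bsub>Q\<^esub> q'"
    using projective_\<kappa>_torsion[OF Q q] by blast
  obtain m p where mp: "m \<in> carrier M" "p \<in> carrier P" "\<phi> (m, p) = (\<zero>\<^bsub>Y\<^esub>, q')"
    using \<phi>_surj[OF Y.zero_closed q'(1)] by blast
  have "\<phi> (t \<odot>\<^bsub>M\<^esub> ?g, \<zero>\<^bsub>P\<^esub>) = \<phi> (\<kappa> \<odot>\<^bsub>M\<^esub> m, \<kappa> \<odot>\<^bsub>P\<^esub> p)"
    using \<phi>_smult[OF t(1) g P.zero_closed] \<phi>_smult[OF \<kappa>_closed mp(1,2)] t(1)
    by (simp add: yq y0 mp(3) q'(2))
  then have "t \<odot>\<^bsub>M\<^esub> ?g = \<kappa> \<odot>\<^bsub>M\<^esub> m \<and> \<zero>\<^bsub>P\<^esub> = \<kappa> \<odot>\<^bsub>P\<^esub> p"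
    using t(1) g mp(1,2) by (intro \<phi>_inj) simp_all
  then show False
    using M_generator[OF t] M_killed_by_\<kappa>[OF mp(1)] by simp
qed

end

section \<open>The ring of the example\<close>

lemma product_ring_cring:
  assumes "\<And>i. i \<in> I \<Longrightarrow> cring (F i)"
  shows "cring (product_ring I F)"
proof -
  let ?R = "product_ring I F"
  have [simp]: "carrier ?R = (\<Pi>\<^sub>E i\<in>I. carrier (F i))" "\<one>\<^bsub>?R\<^esub> = (\<lambda>i\<in>I. \<one>\<^bsub>F i\<^esub>)" "\<zero>\<^bsub>?R\<^esub> = (\<lambda>i\<in>I. \<zero>\<^bsub>F i\<^esub>)"
    "f \<otimes>\<^bsub>?R\<^esub> g = (\<lambda>i\<in>I. f i \<otimes>\<^bsub>F i\<^esub> g i)" "f \<oplus>\<^bsub>?R\<^esub> g = (\<lambda>i\<in>I. f i \<oplus>\<^bsub>F i\<^esub> g i)" for f g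
    by (simp_all add: product_ring_def)
  note F = cring.cring_simprules[OF assms]
  have unit: "(\<lambda>i\<in>I. f i) = f" if "f \<in> carrier ?R" for f
    using that by (simp add: PiE_restrict)
  show ?thesis
  proof (rule cringI)
    show "abelian_group ?R"
    proof (rule abelian_groupI)
      fix f assume f: "f \<in> carrier ?R"
      show "\<zero>\<^bsub>?R\<^esub> \<oplus>\<^bsub>?R\<^esub> f = f"
        using f by (subst (2) unit[symmetric]) (auto intro!: restrict_ext F simp: PiE_iff)
      show "\<exists>g\<in>carrier ?R. g \<oplus>\<^bsub>?R\<^esub> f = \<zero>\<^bsub>?R\<^esub>"
        using f by (intro bexI[of _ "\<lambda>i\<in>I. \<ominus>\<^bsub>F i\<^esub> f i"]) (auto intro!: restrict_ext F simp: PiE_iff)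
    qed (auto intro!: restrict_ext F simp: PiE_iff)
    show "comm_monoid ?R"
    proof (rule comm_monoidI)
      fix f assume f: "f \<in> carrier ?R"
      show "\<one>\<^bsub>?R\<^esub> \<otimes>\<^bsub>?R\<^esub> f = f"
        using f by (subst (2) unit[symmetric]) (auto intro!: restrict_ext F simp: PiE_iff)
    qed (auto intro!: restrict_ext F simp: PiE_iff)
  qed (auto intro!: restrict_ext F simp: PiE_iff)
qed

lemma triangular_ring_simps:
  "carrier (triangular_ring R S) = carrier R \<times> carrier S"
  "\<one>\<^bsub>triangular_ring R S\<^esub> = (\<one>\<^bsub>R\<^esub>, \<zero>\<^bsub>S\<^esub>)"
  "\<zero>\<^bsub>triangular_ring R S\<^esub> = (\<zero>\<^bsub>R\<^esub>, \<zero>\<^bsub>S\<^esub>)"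
  "(r, s) \<otimes>\<^bsub>triangular_ring R S\<^esub> (r', s') =
    (r \<otimes>\<^bsub>R\<^esub> r', (r \<odot>\<^bsub>S\<^esub> s') \<oplus>\<^bsub>S\<^esub> (r' \<odot>\<^bsub>S\<^esub> s))"
  "(r, s) \<oplus>\<^bsub>triangular_ring R S\<^esub> (r', s') = (r \<oplus>\<^bsub>R\<^esub> r', s \<oplus>\<^bsub>S\<^esub> s')"
  by (simp_all add: triangular_ring_def)

lemma triangular_ring_cring:
  assumes "module R S"
  shows "cring (triangular_ring R S)"
proof -
  interpret S: module R S by fact
  let ?A = "triangular_ring R S"
  show ?thesis
  proof (rule cringI)
    show "abelian_group ?A"
    proof (rule abelian_groupI)
      show "\<exists>y\<in>carrier ?A. y \<oplus>\<^bsub>?A\<^esub> x = \<zero>\<^bsub>?A\<^esub>" if "x \<in> carrier ?A" for x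
        using that
        by (intro bexI[of _ "(\<ominus>\<^bsub>R\<^esub> fst x, \<ominus>\<^bsub>S\<^esub> snd x)"])
          (auto simp: triangular_ring_simps S.R.l_neg S.M.l_neg)
    qed (auto simp: triangular_ring_simps S.R.a_ac S.M.a_ac)
    show "comm_monoid ?A"
    proof (rule comm_monoidI)
      fix x y z assume "x \<in> carrier ?A" "y \<in> carrier ?A" "z \<in> carrier ?A"
      moreover obtain a s b t c u where "x = (a, s)" "y = (b, t)" "z = (c, u)"
        by (metis surj_pair)
      moreover have "\<And>a b s. \<lbrakk>a \<in> carrier R; b \<in> carrier R; s \<in> carrier S\<rbrakk> \<Longrightarrow>
          a \<odot>\<^bsub>S\<^esub> (b \<odot>\<^bsub>S\<^esub> s) = b \<odot>\<^bsub>S\<^esub> (a \<odot>\<^bsub>S\<^esub> s)"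
        by (metis S.smult_assoc1 S.R.m_comm)
      ultimately show "x \<otimes>\<^bsub>?A\<^esub> y \<otimes>\<^bsub>?A\<^esub> z = x \<otimes>\<^bsub>?A\<^esub> (y \<otimes>\<^bsub>?A\<^esub> z)"
        by (simp add: triangular_ring_simps S.R.m_assoc S.smult_assoc1 S.smult_r_distr S.M.a_assoc)
    qed (auto simp: triangular_ring_simps S.R.m_comm S.M.a_comm)
  next
    fix x y z assume "x \<in> carrier ?A" "y \<in> carrier ?A" "z \<in> carrier ?A"
    then show "(x \<oplus>\<^bsub>?A\<^esub> y) \<otimes>\<^bsub>?A\<^esub> z = x \<otimes>\<^bsub>?A\<^esub> z \<oplus>\<^bsub>?A\<^esub> y \<otimes>\<^bsub>?A\<^esub> z"
      by (auto simp: triangular_ring_simps S.R.l_distr S.smult_l_distr S.smult_r_distr S.M.a_ac)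
  qed
qed

lemma ring_R_cring: "cring ring_R"
  unfolding ring_R_def
  by (rule product_ring_cring) (rule residues.cring, simp add: residues_def)

lemma ring_R_simps:
  "f \<in> carrier ring_R \<longleftrightarrow> f \<in> extensional {1..} \<and> (\<forall>i\<ge>1. f i = 0 \<or> f i = 1)"
  "\<zero>\<^bsub>ring_R\<^esub> = (\<lambda>i\<in>{1..}. 0)"
  "\<one>\<^bsub>ring_R\<^esub> = (\<lambda>i\<in>{1..}. 1)"
  "f \<otimes>\<^bsub>ring_R\<^esub> g = (\<lambda>i\<in>{1..}. (f i * g i) mod 2)"
proof -
  have "k \<in> {0..2 - 1} \<longleftrightarrow> k = 0 \<or> k = 1" for k :: int by auto
  then show "f \<in> carrier ring_R \<longleftrightarrow> f \<in> extensional {1..} \<and> (\<forall>i\<ge>1. f i = 0 \<or> f i = 1)"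
    by (auto simp: ring_R_def product_ring_def residue_ring_def PiE_iff simp del: atLeastAtMost_iff)
qed (auto simp: ring_R_def product_ring_def residue_ring_def)

lemma ring_R_boolean:
  assumes "f \<in> carrier ring_R"
  shows "f \<otimes>\<^bsub>ring_R\<^esub> f = f"
  using assms by (intro extensionalityI[of _ "{1..}"]) (auto simp: ring_R_simps)

definition coordinate_idempotent :: "nat \<Rightarrow> nat \<Rightarrow> int"
  where "coordinate_idempotent i = (\<lambda>j\<in>{1..}. if j = i then 1 else 0)"

lemma coordinate_idempotent_in_D: "coordinate_idempotent i \<in> ideal_D"
proof -
  have "finite {j \<in> {1..}. coordinate_idempotent i j \<noteq> 0}"
    by (rule finite_subset[of _ "{i}"]) (auto simp: coordinate_idempotent_def)
  then show ?thesis
    by (auto simp: ideal_D_def ring_R_simps coordinate_idempotent_def residue_ring_def)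
qed

lemma coordinate_idempotent_mult:
  assumes "i \<ge> 1" "f \<in> carrier ring_R"
  shows "f \<otimes>\<^bsub>ring_R\<^esub> coordinate_idempotent i =
    (if f i = 0 then \<zero>\<^bsub>ring_R\<^esub> else coordinate_idempotent i)"
  using assms by (auto simp: ring_R_simps coordinate_idempotent_def intro!: restrict_ext)

lemma ring_R_eq_zeroI:
  assumes "f \<in> carrier ring_R"
    and "\<And>i. i \<ge> 1 \<Longrightarrow> f \<otimes>\<^bsub>ring_R\<^esub> coordinate_idempotent i = \<zero>\<^bsub>ring_R\<^esub>"
  shows "f = \<zero>\<^bsub>ring_R\<^esub>"
proof -
  have "f i = 0" if "i \<ge> 1" for i
  proof (rule ccontr)
    assume "f i \<noteq> 0"
    then have "coordinate_idempotent i = \<zero>\<^bsub>ring_R\<^esub>"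
      using assms(2)[OF that] coordinate_idempotent_mult[OF that assms(1)] by simp
    then have "coordinate_idempotent i i = \<zero>\<^bsub>ring_R\<^esub> i" by simp
    then show False
      using that by (simp add: coordinate_idempotent_def ring_R_simps)
  qed
  then show ?thesis
    using assms(1) by (intro extensionalityI[of _ "{1..}"]) (auto simp: ring_R_simps)
qed

text \<open>Everything rests on \<open>T S = 0\<close> and \<open>D \<subseteq> T\<close>. Because \<open>S\<close> is generated by the coset of \<open>1\<close>, the
  multiples of \<open>\<kappa>\<close> are exactly the pairs \<open>(0, s)\<close>. If \<open>\<kappa> (r, s) = 0\<close> then \<open>r \<in> T\<close>; the factor
  required for \<open>(r, s)\<close> is \<open>(1 - r, 0)\<close>, as \<open>(1 - r) r = 0\<close> in the Boolean ring \<open>R\<close>.\<close>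

lemma ring_A_atoms:
  fixes T :: "(nat \<Rightarrow> int) set"
  assumes max: "maximalideal T ring_R" and D: "ideal_D \<subseteq> T"
  defines "\<kappa> \<equiv> (\<zero>\<^bsub>ring_R\<^esub>, T +>\<^bsub>ring_R\<^esub> \<one>\<^bsub>ring_R\<^esub>)"
  shows "atoms_with_nilpotent_annihilator (ring_A T)
      ((\<lambda>i. (coordinate_idempotent i, \<zero>\<^bsub>module_S T\<^esub>)) ` {1..}) \<kappa>" (is ?atoms)
    and "ideal_J T = PIdl\<^bsub>ring_A T\<^esub> \<kappa>"
proof -
  interpret R: cring ring_R by (rule ring_R_cring)
  interpret T: maximalideal T ring_R by (rule max)
  interpret S: module ring_R "module_S T"
    unfolding module_S_def by (rule T.quotient_module_is_module[OF ring_R_cring])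
  interpret A: cring "ring_A T"
    unfolding ring_A_def by (rule triangular_ring_cring) (rule S.module_axioms)
  note A_simps = triangular_ring_simps[of ring_R "module_S T", folded ring_A_def]
  let ?c = coordinate_idempotent
  let ?u = "T +>\<^bsub>ring_R\<^esub> \<one>\<^bsub>ring_R\<^esub>"
  have T_sub: "x \<in> carrier ring_R" if "x \<in> T" for x
    using that T.a_subset by blast
  have S_carrier: "s \<in> carrier (module_S T) \<longleftrightarrow> (\<exists>x\<in>carrier ring_R. s = T +>\<^bsub>ring_R\<^esub> x)" for s
    by (auto simp: module_S_def quotient_module_simps A_RCOSETS_def')
  have S_zero: "\<zero>\<^bsub>module_S T\<^esub> = T"
    by (simp add: module_S_def quotient_module_simps)
  have S_smult: "a \<odot>\<^bsub>module_S T\<^esub> (T +>\<^bsub>ring_R\<^esub> x) = T +>\<^bsub>ring_R\<^esub> (a \<otimes>\<^bsub>ring_R\<^esub> x)"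
    if "a \<in> carrier ring_R" "x \<in> carrier ring_R" for a x
    unfolding module_S_def by (rule T.quotient_module_smult[OF that])
  have u: "?u \<in> carrier (module_S T)"
    by (auto simp: S_carrier)
  have u_gen: "x \<odot>\<^bsub>module_S T\<^esub> ?u = T +>\<^bsub>ring_R\<^esub> x" if "x \<in> carrier ring_R" for x
    using that by (simp add: S_smult)
  have T_kills: "a \<odot>\<^bsub>module_S T\<^esub> s = \<zero>\<^bsub>module_S T\<^esub>" if a: "a \<in> T" and s: "s \<in> carrier (module_S T)" for a s
  proof -
    obtain x where x: "x \<in> carrier ring_R" "s = T +>\<^bsub>ring_R\<^esub> x"
      using s S_carrier by blast
    have "a \<otimes>\<^bsub>ring_R\<^esub> x \<in> T"
      using T.I_r_closed[OF a x(1)] .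
    then show ?thesis
      using T_sub[OF a] x by (simp add: S_smult S_zero T.coset_eq_iff)
  qed
  have cT: "?c i \<in> T" for i
    using D coordinate_idempotent_in_D by blast
  note c = T_sub[OF cT]
  have \<kappa>: "\<kappa> \<in> carrier (ring_A T)"
    using u by (simp add: \<kappa>_def A_simps)
  have mult_\<kappa>: "(r, s) \<otimes>\<^bsub>ring_A T\<^esub> \<kappa> = (\<zero>\<^bsub>ring_R\<^esub>, T +>\<^bsub>ring_R\<^esub> r)"
    if "r \<in> carrier ring_R" "s \<in> carrier (module_S T)" for r s
    using that u S.smult_closed[OF that(1) u] by (simp add: \<kappa>_def A_simps u_gen)
  show J: "ideal_J T = PIdl\<^bsub>ring_A T\<^esub> \<kappa>"
  proof
    show "ideal_J T \<subseteq> PIdl\<^bsub>ring_A T\<^esub> \<kappa>"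
    proof
      fix z assume "z \<in> ideal_J T"
      then obtain x where x: "x \<in> carrier ring_R" "z = (\<zero>\<^bsub>ring_R\<^esub>, T +>\<^bsub>ring_R\<^esub> x)"
        by (auto simp: ideal_J_def S_carrier)
      then have "z = (x, \<zero>\<^bsub>module_S T\<^esub>) \<otimes>\<^bsub>ring_A T\<^esub> \<kappa>"
        by (simp add: mult_\<kappa>)
      then show "z \<in> PIdl\<^bsub>ring_A T\<^esub> \<kappa>"
        using x(1) unfolding cgenideal_def by (auto simp: A_simps)
    qed
    show "PIdl\<^bsub>ring_A T\<^esub> \<kappa> \<subseteq> ideal_J T"
    proof
      fix z assume "z \<in> PIdl\<^bsub>ring_A T\<^esub> \<kappa>"
      then obtain r s where "r \<in> carrier ring_R" "s \<in> carrier (module_S T)"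
        "z = (r, s) \<otimes>\<^bsub>ring_A T\<^esub> \<kappa>"
        by (auto simp: cgenideal_def A_simps)
      then show "z \<in> ideal_J T"
        using S_carrier by (auto simp: mult_\<kappa> ideal_J_def)
    qed
  qed
  show ?atoms
  proof
    show "(\<lambda>i. (?c i, \<zero>\<^bsub>module_S T\<^esub>)) ` {1..} \<subseteq> carrier (ring_A T)"
      using c by (auto simp: A_simps)
    show "\<kappa> \<in> carrier (ring_A T)" by (rule \<kappa>)
    show "\<kappa> \<noteq> \<zero>\<^bsub>ring_A T\<^esub>"
    proof
      assume "\<kappa> = \<zero>\<^bsub>ring_A T\<^esub>"
      then have "\<one>\<^bsub>ring_R\<^esub> \<in> T"
        by (simp add: \<kappa>_def A_simps S_zero T.coset_eq_iff)
      then show False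
        using T.one_imp_carrier T.I_notcarr by simp
    qed
    show "\<kappa> \<otimes>\<^bsub>ring_A T\<^esub> \<kappa> = \<zero>\<^bsub>ring_A T\<^esub>"
      using mult_\<kappa>[OF R.zero_closed u] by (simp add: \<kappa>_def A_simps S_zero T.coset_eq_iff)
  next
    fix e assume "e \<in> (\<lambda>i. (?c i, \<zero>\<^bsub>module_S T\<^esub>)) ` {1..}"
    then obtain i where i: "i \<ge> 1" and e: "e = (?c i, \<zero>\<^bsub>module_S T\<^esub>)" by auto
    show "e \<otimes>\<^bsub>ring_A T\<^esub> e = e"
      using c[of i] by (simp add: e A_simps ring_R_boolean)
    show "e \<otimes>\<^bsub>ring_A T\<^esub> \<kappa> = \<zero>\<^bsub>ring_A T\<^esub>"
      using mult_\<kappa>[OF c S.zero_closed] c cT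
      by (simp add: e A_simps(3) S_zero T.coset_eq_iff)
    fix a assume "a \<in> carrier (ring_A T)"
    then obtain r s where a: "a = (r, s)" "r \<in> carrier ring_R" "s \<in> carrier (module_S T)"
      by (auto simp: A_simps)
    have "a \<otimes>\<^bsub>ring_A T\<^esub> e = (r \<otimes>\<^bsub>ring_R\<^esub> ?c i, \<zero>\<^bsub>module_S T\<^esub>)"
      using a c[of i] T_kills[OF cT a(3)] by (simp add: e A_simps)
    then show "a \<otimes>\<^bsub>ring_A T\<^esub> e = \<zero>\<^bsub>ring_A T\<^esub> \<or> a \<otimes>\<^bsub>ring_A T\<^esub> e = e"
      using a i by (simp add: coordinate_idempotent_mult A_simps e)
  next
    fix a assume "a \<in> carrier (ring_A T)"
      and ann: "\<And>e. e \<in> (\<lambda>i. (?c i, \<zero>\<^bsub>module_S T\<^esub>)) ` {1..} \<Longrightarrow> e \<otimes>\<^bsub>ring_A T\<^esub> a = \<zero>\<^bsub>ring_A T\<^esub>"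
    then obtain r s where a: "a = (r, s)" "r \<in> carrier ring_R" "s \<in> carrier (module_S T)"
      by (auto simp: A_simps)
    have "r = \<zero>\<^bsub>ring_R\<^esub>"
    proof (rule ring_R_eq_zeroI[OF a(2)])
      fix i :: nat assume "i \<ge> 1"
      then have "?c i \<otimes>\<^bsub>ring_R\<^esub> r = \<zero>\<^bsub>ring_R\<^esub>"
        using ann[of "(?c i, \<zero>\<^bsub>module_S T\<^esub>)"] by (auto simp: a A_simps)
      then show "r \<otimes>\<^bsub>ring_R\<^esub> ?c i = \<zero>\<^bsub>ring_R\<^esub>"
        using R.m_comm[OF c a(2)] by simp
    qed
    then show "a \<in> PIdl\<^bsub>ring_A T\<^esub> \<kappa>"
      using a by (simp add: J[symmetric] ideal_J_def)
  next
    fix a assume "a \<in> carrier (ring_A T)" and ann: "\<kappa> \<otimes>\<^bsub>ring_A T\<^esub> a = \<zero>\<^bsub>ring_A T\<^esub>"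
    then obtain r s where a: "a = (r, s)" "r \<in> carrier ring_R" "s \<in> carrier (module_S T)"
      by (auto simp: A_simps)
    have "T +>\<^bsub>ring_R\<^esub> r = T"
      using ann A.m_comm[OF \<kappa>, of a] \<open>a \<in> _\<close> by (simp add: a mult_\<kappa> A_simps S_zero)
    then have r: "r \<in> T"
      using a(2) by (simp add: T.coset_eq_iff)
    let ?t = "\<one>\<^bsub>ring_R\<^esub> \<ominus>\<^bsub>ring_R\<^esub> r"
    have t: "?t \<in> carrier ring_R" using a by simp
    have "?t \<in> T +>\<^bsub>ring_R\<^esub> \<one>\<^bsub>ring_R\<^esub>"
      using r a(2) by (auto simp: T.a_rcos_module R.minus_eq R.a_comm[of "\<one>\<^bsub>ring_R\<^esub>"] R.a_assoc R.r_neg)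
    then have "T +>\<^bsub>ring_R\<^esub> ?t = ?u"
      using T.a_repr_independence' by simp
    then have "(?t, \<zero>\<^bsub>module_S T\<^esub>) \<otimes>\<^bsub>ring_A T\<^esub> \<kappa> = \<kappa>"
      using t by (simp add: mult_\<kappa>) (simp add: \<kappa>_def)
    moreover have "?t \<otimes>\<^bsub>ring_R\<^esub> r = \<zero>\<^bsub>ring_R\<^esub>"
      using a(2) by (simp add: R.minus_eq R.l_distr R.l_minus ring_R_boolean R.r_neg)
    then have "(?t, \<zero>\<^bsub>module_S T\<^esub>) \<otimes>\<^bsub>ring_A T\<^esub> a \<in> PIdl\<^bsub>ring_A T\<^esub> \<kappa>"
      using a t by (simp add: J[symmetric] ideal_J_def A_simps)
    ultimately show "\<exists>t\<in>carrier (ring_A T). t \<otimes>\<^bsub>ring_A T\<^esub> \<kappa> = \<kappa> \<and>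
        t \<otimes>\<^bsub>ring_A T\<^esub> a \<in> PIdl\<^bsub>ring_A T\<^esub> \<kappa>"
      using t by (intro bexI[of _ "(?t, \<zero>\<^bsub>module_S T\<^esub>)"]) (auto simp: A_simps)
  qed
qed

theorem mainTheorem3:
  fixes T :: "(nat \<Rightarrow> int) set"
  assumes "maximalideal T ring_R" and "ideal_D \<subseteq> T"
  shows "cyclically_presented (ring_A T) (module_M T) \<and>
    \<not> projective_module (ring_A T) (module_M T) \<and>
    (\<forall>N. submodule N (ring_A T) (module_M T) \<and>
         stable_module (ring_A T) ((module_M T)\<lparr>carrier := N\<rparr>)
       \<longrightarrow> N = {\<zero>\<^bsub>module_M T\<^esub>}) \<and>
    \<not> (\<exists>P N. internal_dirsum (ring_A T) (module_M T) P N \<and>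
         projective_module (ring_A T) ((module_M T)\<lparr>carrier := P\<rparr>) \<and>
         stable_module (ring_A T) ((module_M T)\<lparr>carrier := N\<rparr>)) \<and>
    (\<forall>Y :: ((nat \<Rightarrow> int) \<times> (nat \<Rightarrow> int) set, 'y) module.
       stable_module (ring_A T) Y \<longrightarrow>
       \<not> projectively_equivalent TYPE('p) TYPE('q) (ring_A T) (module_M T) Y)"
proof -
  interpret atoms_with_nilpotent_annihilator "ring_A T"
    "(\<lambda>i. (coordinate_idempotent i, \<zero>\<^bsub>module_S T\<^esub>)) ` {1..}"
    "(\<zero>\<^bsub>ring_R\<^esub>, T +>\<^bsub>ring_R\<^esub> \<one>\<^bsub>ring_R\<^esub>)"
    by (rule ring_A_atoms(1)[OF assms])
  have M: "module_M T = quotient_module (ring_A T) (PIdl\<^bsub>ring_A T\<^esub> (\<zero>\<^bsub>ring_R\<^esub>, T +>\<^bsub>ring_R\<^esub> \<one>\<^bsub>ring_R\<^esub>))"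
    by (simp add: module_M_def ring_A_atoms(2)[OF assms])
  show ?thesis
    unfolding M
    using M_cyclically_presented M_not_projective M_no_stable_submodule
      M_no_projective_stable_decomposition M_not_projectively_equivalent_to_stable
    by blast
qed

end
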